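(* Let $L\subseteq[0,\infty)^r$ be an additive semigroup with $0\in L$ and $w$ an admissible weight function on $L$. If $a\in\mathscr A_w(L)$ satisfies $0\notin\overline{\widetilde a(\mathbb H^r)}$, then $a$ is invertible in $\mathscr A_w(L)$.
   Context: $\mathbb H=\{\operatorname{Re}s>0\}$. A weight function is $w\colon L\to(0,\infty)$ with $w(0)=1$, $w(\lambda+\lambda')\le w(\lambda)w(\lambda')$; admissible: $w\ge1$ and $\lim_{k\to\infty}w(k\lambda)^{1/k}=1$ for all $\lambda\in L$. $\mathscr A_w(L)$: functions $a\colon L\to\mathbb C$ with $\sum_{\lambda\in L}|a(\lambda)|w(\lambda)<\infty$ and convolution $(a*b)(\lambda)=\sum_{\lambda'+\lambda''=\lambda}a(\lambda')b(\lambda'')$. For $\lambda=(\lambda_1,\dots,\lambda_r)$ and $s=(s_1,\dots,s_r)$ put $\lambda\cdot s=\sum\lambda_\varrho s_\varrho$ and $\widetilde a(s)=\sum_{\lambda\in L}a(\lambda)e^{-\lambda\cdot s}$ for $s\in\overline{\mathbb H}^r$. *)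

theory Defs
  imports "HOL-Analysis.Analysis"
begin

definition nonneg_semigroup :: "(real ^ 'r) set \<Rightarrow> bool" where
  "nonneg_semigroup L \<longleftrightarrow> 0 \<in> L \<and> (\<forall>x\<in>L. \<forall>y\<in>L. x + y \<in> L) \<and> (\<forall>x\<in>L. \<forall>i. 0 \<le> x $ i)"

definition weight_function :: "(real ^ 'r) set \<Rightarrow> (real ^ 'r \<Rightarrow> real) \<Rightarrow> bool" where
  "weight_function L w \<longleftrightarrow> (\<forall>l\<in>L. 0 < w l) \<and> w 0 = 1 \<and>
     (\<forall>l\<in>L. \<forall>l'\<in>L. w (l + l') \<le> w l * w l')"

definition admissible_weight :: "(real ^ 'r) set \<Rightarrow> (real ^ 'r \<Rightarrow> real) \<Rightarrow> bool" where
  "admissible_weight L w \<longleftrightarrow> weight_function L w \<and> (\<forall>l\<in>L. 1 \<le> w l) \<and>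
     (\<forall>l\<in>L. (\<lambda>k::nat. w (real k *\<^sub>R l) powr (1 / real k)) \<longlonglongrightarrow> 1)"

definition Aw :: "(real ^ 'r) set \<Rightarrow> (real ^ 'r \<Rightarrow> real) \<Rightarrow> (real ^ 'r \<Rightarrow> complex) set" where
  "Aw L w = {a. (\<lambda>l. norm (a l) * w l) summable_on L}"

definition conv :: "(real ^ 'r) set \<Rightarrow> (real ^ 'r \<Rightarrow> complex) \<Rightarrow> (real ^ 'r \<Rightarrow> complex) \<Rightarrow> real ^ 'r \<Rightarrow> complex" where
  "conv L a b l = (\<Sum>\<^sub>\<infinity>(x, y) \<in> {(x, y). x \<in> L \<and> y \<in> L \<and> x + y = l}. a x * b y)"

definition unit_elem :: "real ^ 'r \<Rightarrow> complex" where
  "unit_elem l = (if l = 0 then 1 else 0)"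

definition dotc :: "real ^ 'r \<Rightarrow> complex ^ 'r \<Rightarrow> complex" where
  "dotc l s = (\<Sum>i\<in>UNIV. of_real (l $ i) * s $ i)"

definition transform :: "(real ^ 'r) set \<Rightarrow> (real ^ 'r \<Rightarrow> complex) \<Rightarrow> complex ^ 'r \<Rightarrow> complex" where
  "transform L a s = (\<Sum>\<^sub>\<infinity>l\<in>L. a l * exp (- dotc l s))"

definition Hr :: "(complex ^ 'r) set" where
  "Hr = {s. \<forall>i. 0 < Re (s $ i)}"

end

theory Submission
  imports Defs "HOL-Complex_Analysis.Great_Picard"
begin

text \<open>Approximate \<open>a\<close> in \<open>A\<^sub>w(L)\<close> by a finitely supported \<open>p\<close>, whose transform is still bounded away
  from \<open>0\<close>. For large real part, \<open>1 / p\<close> is a generalized Dirichlet series by a Neumann series. Its powers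
  are bounded and holomorphic slightly beyond the imaginary boundary, since \<open>p\<close> has only finitely many
  frequencies; mean values over vertical translates then bound the coefficients of \<open>1 / p\<^sup>m\<close> at
  \<open>\<lambda>\<close> by \<open>\<eta>\<^sup>-\<^sup>m exp(- \<epsilon> (\<lambda>\<^sub>1 + \<dots> + \<lambda>\<^sub>r))\<close>. As these coefficients live on a finitely generated
  semigroup, admissibility of \<open>w\<close> bounds the \<open>w\<close>-norm of \<open>1 / p\<^sup>m\<close> by a constant times \<open>\<eta>\<^sup>-\<^sup>m\<close>, so
  the series \<open>\<Sum>\<^sub>k (p - a)\<^sup>k / p\<^sup>k\<^sup>+\<^sup>1\<close> converges in \<open>A\<^sub>w(L)\<close> to the inverse of \<open>a\<close>.
  The characters \<open>\<lambda> \<mapsto> exp(- \<lambda> \<cdot> s)\<close> need not be dense in the Gelfand spectrum of \<open>A\<^sub>w(L)\<close>,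
  so a direct appeal to Gelfand theory would not suffice.\<close>

no_notation Infinite_Set_Sum.abs_summable_on (infix "abs'_summable'_on" 50)

section \<open>Products and fibrewise sums of absolutely summable families\<close>

lemma abs_summable_times:
  fixes f :: "'a \<Rightarrow> 'c::real_normed_div_algebra" and g :: "'b \<Rightarrow> 'c"
  assumes "f abs_summable_on A" "g abs_summable_on B"
  shows "(\<lambda>(x, y). f x * g y) abs_summable_on A \<times> B"
  unfolding Infinite_Sum.abs_summable_on_Sigma_iff
proof (intro conjI ballI)
  show "(\<lambda>y. case (x, y) of (x, y) \<Rightarrow> f x * g y) abs_summable_on B" for x
    using assms(2) by (simp add: norm_mult summable_on_cmult_right)
  have "(\<lambda>x. norm (f x) * (\<Sum>\<^sub>\<infinity>y\<in>B. norm (g y))) abs_summable_on A"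
    using summable_on_cmult_left[OF assms(1), of "\<Sum>\<^sub>\<infinity>y\<in>B. norm (g y)"]
    by (simp add: abs_mult infsum_nonneg)
  then show "(\<lambda>x. \<Sum>\<^sub>\<infinity>y\<in>B. norm (case (x, y) of (x, y) \<Rightarrow> f x * g y)) abs_summable_on A"
    by (simp add: norm_mult infsum_cmult_right')
qed

lemma infsum_times:
  fixes f :: "'a \<Rightarrow> 'c::{real_normed_div_algebra, banach}" and g :: "'b \<Rightarrow> 'c"
  assumes "f abs_summable_on A" "g abs_summable_on B"
  shows "(\<Sum>\<^sub>\<infinity>(x, y)\<in>A \<times> B. f x * g y) = infsum f A * infsum g B"
proof -
  have "(\<lambda>(x, y). f x * g y) summable_on A \<times> B"
    using abs_summable_times[OF assms] by (rule abs_summable_summable)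
  then have "(\<Sum>\<^sub>\<infinity>(x, y)\<in>A \<times> B. f x * g y) = (\<Sum>\<^sub>\<infinity>x\<in>A. \<Sum>\<^sub>\<infinity>y\<in>B. f x * g y)"
    by (simp add: infsum_Sigma'_banach)
  also have "\<dots> = infsum f A * infsum g B"
    using assms by (simp add: infsum_cmult_right' infsum_cmult_left')
  finally show ?thesis .
qed

text \<open>The disjoint union of the fibres of \<open>h\<close> is in bijection with
  \<open>X\<close> through \<open>snd\<close>, so this is Fubini on a Sigma set. With
  \<open>h\<close> the addition on \<open>L \<times> L\<close> it evaluates sums over
  convolutions.\<close>

lemma fibre_sums:
  fixes f :: "'a \<Rightarrow> 'c::banach"
  assumes "f summable_on X" "\<And>x. x \<in> X \<Longrightarrow> h x \<in> L"
  shows "(\<lambda>l. \<Sum>\<^sub>\<infinity>x\<in>{x\<in>X. h x = l}. f x) summable_on L"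
    and "(\<Sum>\<^sub>\<infinity>l\<in>L. \<Sum>\<^sub>\<infinity>x\<in>{x\<in>X. h x = l}. f x) = infsum f X"
proof -
  let ?S = "Sigma L (\<lambda>l. {x\<in>X. h x = l})"
  have bij: "bij_betw snd ?S X"
    by (rule bij_betwI[where g = "\<lambda>x. (h x, x)"]) (use assms(2) in auto)
  have s: "(\<lambda>p. f (snd p)) summable_on ?S"
    using summable_on_reindex_bij_betw[OF bij, of f] assms(1) by simp
  show "(\<lambda>l. \<Sum>\<^sub>\<infinity>x\<in>{x\<in>X. h x = l}. f x) summable_on L"
    using summable_on_Sigma_banach[of "\<lambda>l x. f x" L] s by (simp add: case_prod_unfold)
  show "(\<Sum>\<^sub>\<infinity>l\<in>L. \<Sum>\<^sub>\<infinity>x\<in>{x\<in>X. h x = l}. f x) = infsum f X"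
    using infsum_Sigma_banach[OF s] infsum_reindex_bij_betw[OF bij, of f] by simp
qed

section \<open>Weighted convolution algebras\<close>

definition wnorm :: "(real ^ 'r) set \<Rightarrow> (real ^ 'r \<Rightarrow> real) \<Rightarrow> (real ^ 'r \<Rightarrow> complex) \<Rightarrow> real" where
  "wnorm L w a = (\<Sum>\<^sub>\<infinity>l\<in>L. norm (a l) * w l)"

text \<open>Where the character is dominated by the weight, the transform is bounded by the weighted
  norm and multiplicative. Two kinds of weights are meant: the given \<open>w\<close>, whose domain
  contains \<open>Hr\<close>, and exponential weights, whose domain contains only points far enough
  to the right.\<close>

definition transform_domain :: "(real ^ 'r) set \<Rightarrow> (real ^ 'r \<Rightarrow> real) \<Rightarrow> (complex ^ 'r) set" where
  "transform_domain L w = {s. \<forall>l\<in>L. norm (exp (- dotc l s)) \<le> w l}"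

lemma dotc_add: "dotc (l + l') s = dotc l s + dotc l' s"
  by (simp add: dotc_def algebra_simps sum.distrib)

lemma dotc_0 [simp]: "dotc 0 s = 0"
  by (simp add: dotc_def)

lemma Aw_D: "a \<in> Aw L w \<Longrightarrow> (\<lambda>l. norm (a l) * w l) summable_on L"
  by (simp add: Aw_def)

lemma transform_abs_summable:
  assumes "a \<in> Aw L w" "s \<in> transform_domain L w"
  shows "(\<lambda>l. a l * exp (- dotc l s)) abs_summable_on L"
  by (rule summable_on_comparison_test[OF Aw_D[OF assms(1)]])
    (use assms(2) in \<open>auto simp: norm_mult transform_domain_def intro!: mult_left_mono simp del: norm_exp_eq_Re\<close>)

lemma transform_summable:
  assumes "a \<in> Aw L w" "s \<in> transform_domain L w"
  shows "(\<lambda>l. a l * exp (- dotc l s)) summable_on L"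
  using transform_abs_summable[OF assms] by (rule abs_summable_summable)

lemma norm_transform_le:
  assumes "a \<in> Aw L w" "s \<in> transform_domain L w"
  shows "norm (transform L a s) \<le> wnorm L w a"
proof -
  have "norm (transform L a s) \<le> (\<Sum>\<^sub>\<infinity>l\<in>L. norm (a l * exp (- dotc l s)))"
    unfolding transform_def by (rule norm_infsum_bound[OF transform_abs_summable[OF assms]])
  also have "\<dots> \<le> wnorm L w a"
    unfolding wnorm_def
    by (rule infsum_mono[OF transform_abs_summable[OF assms] Aw_D[OF assms(1)]])
      (use assms(2) in \<open>auto simp: norm_mult transform_domain_def intro!: mult_left_mono simp del: norm_exp_eq_Re\<close>)
  finally show ?thesis .
qed

lemma transform_diff:
  assumes "a \<in> Aw L w" "b \<in> Aw L w" "s \<in> transform_domain L w"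
  shows "transform L (\<lambda>l. a l - b l) s = transform L a s - transform L b s"
proof -
  have b: "(\<lambda>l. - (b l * exp (- dotc l s))) summable_on L"
    unfolding summable_on_uminus by (rule transform_summable[OF assms(2,3)])
  have "transform L (\<lambda>l. a l - b l) s
      = (\<Sum>\<^sub>\<infinity>l\<in>L. a l * exp (- dotc l s) + - (b l * exp (- dotc l s)))"
    unfolding transform_def by (rule infsum_cong) (simp add: left_diff_distrib)
  also have "\<dots> = transform L a s + (\<Sum>\<^sub>\<infinity>l\<in>L. - (b l * exp (- dotc l s)))"
    unfolding infsum_add[OF transform_summable[OF assms(1,3)] b] transform_def ..
  also have "\<dots> = transform L a s - transform L b s"
    unfolding infsum_uminus transform_def by simp
  finally show ?thesis .
qed

lemma Aw_cmult:
  assumes "a \<in> Aw L w"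
  shows "(\<lambda>l. c * a l) \<in> Aw L w"
  using summable_on_cmult_right[OF Aw_D[OF assms], of "norm c"]
  by (simp add: Aw_def norm_mult mult.assoc)

lemma transform_cmult: "transform L (\<lambda>l. c * a l) s = c * transform L a s"
  by (simp add: transform_def mult.assoc infsum_cmult_right')

lemma Aw_diff:
  assumes "a \<in> Aw L w" "b \<in> Aw L w" "\<And>l. l \<in> L \<Longrightarrow> 0 \<le> w l"
  shows "(\<lambda>l. a l - b l) \<in> Aw L w"
  unfolding Aw_def mem_Collect_eq
proof (rule summable_on_comparison_test[OF summable_on_add[OF Aw_D[OF assms(1)] Aw_D[OF assms(2)]]])
  fix l assume "l \<in> L"
  show "norm (a l - b l) * w l \<le> norm (a l) * w l + norm (b l) * w l"
    using mult_right_mono[OF norm_triangle_ineq4[of "a l" "b l"] assms(3)[OF \<open>l \<in> L\<close>]]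
    by (simp add: algebra_simps)
qed (use assms(3) in auto)

lemma finite_support:
  assumes "\<And>l. l \<notin> F \<Longrightarrow> a l = 0" "finite F" "F \<subseteq> L"
  shows "a \<in> Aw L w" "transform L a s = (\<Sum>l\<in>F. a l * exp (- dotc l s))"
    "wnorm L w a = (\<Sum>l\<in>F. norm (a l) * w l)"
proof -
  have "(\<lambda>l. norm (a l) * w l) summable_on L \<longleftrightarrow> (\<lambda>l. norm (a l) * w l) summable_on F"
    by (rule summable_on_cong_neutral) (use assms in auto)
  then show "a \<in> Aw L w"
    using assms by (simp add: Aw_def)
  have "transform L a s = (\<Sum>\<^sub>\<infinity>l\<in>F. a l * exp (- dotc l s))"
    unfolding transform_def by (rule infsum_cong_neutral) (use assms in auto)
  then show "transform L a s = (\<Sum>l\<in>F. a l * exp (- dotc l s))"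
    using assms by simp
  have "wnorm L w a = (\<Sum>\<^sub>\<infinity>l\<in>F. norm (a l) * w l)"
    unfolding wnorm_def by (rule infsum_cong_neutral) (use assms in auto)
  then show "wnorm L w a = (\<Sum>l\<in>F. norm (a l) * w l)"
    using assms by simp
qed

lemma unit_elem_facts:
  assumes "nonneg_semigroup L" "weight_function L w"
  shows "unit_elem \<in> Aw L w" "transform L unit_elem s = 1" "wnorm L w unit_elem = 1"
proof -
  have "0 \<in> L" using assms(1) by (simp add: nonneg_semigroup_def)
  then show "unit_elem \<in> Aw L w" "transform L unit_elem s = 1" "wnorm L w unit_elem = 1"
    using finite_support[of "{0}" unit_elem L] assms(2)
    by (auto simp: unit_elem_def weight_function_def)
qed

text \<open>Submultiplicativity of \<open>w\<close> dominates each weighted convolution sum by the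
  sum of a product family over the fibre of addition; \<open>fibre_sums\<close> then gives
  membership and the norm bound. The same regrouping, with characters in place of weights, gives
  multiplicativity of the transform.\<close>

lemma conv_weighted:
  assumes L: "nonneg_semigroup L" and w: "weight_function L w"
    and a: "a \<in> Aw L w" and b: "b \<in> Aw L w"
  shows "conv L a b \<in> Aw L w"
    and "wnorm L w (conv L a b) \<le> wnorm L w a * wnorm L w b"
    and "s \<in> transform_domain L w \<Longrightarrow> transform L (conv L a b) s = transform L a s * transform L b s"
proof -
  let ?P = "\<lambda>l. {p \<in> L \<times> L. fst p + snd p = l}"
  have conv: "conv L a b l = (\<Sum>\<^sub>\<infinity>(x, y)\<in>?P l. a x * b y)" for l
    unfolding conv_def by (rule arg_cong2[where f = infsum]) auto
  have pos: "0 \<le> w l" if "l \<in> L" for l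
    using w that by (force simp: weight_function_def)
  have mem: "fst p + snd p \<in> L" if "p \<in> L \<times> L" for p
    using L that by (auto simp: nonneg_semigroup_def)
  let ?g = "\<lambda>p. case p of (x, y) \<Rightarrow> (norm (a x) * w x) * (norm (b y) * w y)"
  have a': "(\<lambda>l. norm (a l) * w l) abs_summable_on L" and b': "(\<lambda>l. norm (b l) * w l) abs_summable_on L"
    by (rule summable_on_iff_abs_summable_on_real[THEN iffD1], rule Aw_D[OF a],
        rule summable_on_iff_abs_summable_on_real[THEN iffD1], rule Aw_D[OF b])
  have g: "?g summable_on L \<times> L"
    using abs_summable_times[OF a' b'] by (rule abs_summable_summable)
  have gi: "infsum ?g (L \<times> L) = wnorm L w a * wnorm L w b"
    unfolding wnorm_def by (rule infsum_times[OF a' b'])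
  note fib = fibre_sums[OF g mem]
  have le: "norm (conv L a b l) * w l \<le> infsum ?g (?P l)" if l: "l \<in> L" for l
  proof -
    have gP: "?g summable_on ?P l"
      by (rule summable_on_subset_banach[OF g]) auto
    have le1: "norm (case p of (x, y) \<Rightarrow> a x * b y) * w l \<le> ?g p" if pP: "p \<in> ?P l" for p
    proof -
      obtain x y where p: "p = (x, y)" "x \<in> L" "y \<in> L" "x + y = l" using pP by (cases p) auto
      have "w l \<le> w x * w y" using w p by (auto simp: weight_function_def)
      from mult_left_mono[OF this, of "norm (a x) * norm (b y)"] show ?thesis
        by (simp add: p norm_mult algebra_simps)
    qed
    have s: "(\<lambda>p. norm (case p of (x, y) \<Rightarrow> a x * b y) * w l) summable_on ?P l"
      by (rule summable_on_comparison_test[OF gP le1]) (use pos[OF l] in auto)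
    \<comment> \<open>Dividing by the positive weight recovers absolute convergence of the
      convolution sum itself, which the norm bound for infinite sums requires.\<close>
    have wl: "w l > 0" using w l by (simp add: weight_function_def)
    have "(\<lambda>p. case p of (x, y) \<Rightarrow> a x * b y) abs_summable_on ?P l"
      using summable_on_cmult_left[OF s, of "1 / w l"] wl by simp
    then have "norm (conv L a b l) * w l \<le> (\<Sum>\<^sub>\<infinity>p\<in>?P l. norm (case p of (x, y) \<Rightarrow> a x * b y)) * w l"
      unfolding conv by (intro mult_right_mono norm_infsum_bound) (use wl in auto)
    also have "\<dots> = (\<Sum>\<^sub>\<infinity>p\<in>?P l. norm (case p of (x, y) \<Rightarrow> a x * b y) * w l)"
      by (simp add: infsum_cmult_left')
    also have "\<dots> \<le> infsum ?g (?P l)"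
      by (rule infsum_mono[OF s gP le1])
    finally show ?thesis .
  qed
  have s: "(\<lambda>l. norm (conv L a b l) * w l) summable_on L"
    by (rule summable_on_comparison_test[OF fib(1) le]) (use pos in auto)
  then show "conv L a b \<in> Aw L w" by (simp add: Aw_def)
  have "wnorm L w (conv L a b) \<le> (\<Sum>\<^sub>\<infinity>l\<in>L. infsum ?g (?P l))"
    unfolding wnorm_def by (rule infsum_mono[OF s fib(1) le])
  then show "wnorm L w (conv L a b) \<le> wnorm L w a * wnorm L w b"
    using fib(2) gi by simp
  assume sd: "s \<in> transform_domain L w"
  let ?e = "\<lambda>l. exp (- dotc l s)"
  let ?h = "\<lambda>p. case p of (x, y) \<Rightarrow> (a x * ?e x) * (b y * ?e y)"
  note as = transform_abs_summable[OF a sd] and bs = transform_abs_summable[OF b sd]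
  have h: "?h summable_on L \<times> L"
    using abs_summable_times[OF as bs] by (rule abs_summable_summable)
  have "transform L (conv L a b) s = (\<Sum>\<^sub>\<infinity>l\<in>L. infsum ?h (?P l))"
    unfolding transform_def
  proof (rule infsum_cong)
    fix l
    have "conv L a b l * ?e l = (\<Sum>\<^sub>\<infinity>p\<in>?P l. (case p of (x, y) \<Rightarrow> a x * b y) * ?e l)"
      by (simp only: conv infsum_cmult_left')
    also have "\<dots> = infsum ?h (?P l)"
      by (rule infsum_cong) (auto simp: dotc_add exp_add exp_diff exp_minus field_simps)
    finally show "conv L a b l * ?e l = infsum ?h (?P l)" .
  qed
  also have "\<dots> = infsum ?h (L \<times> L)"
    by (rule fibre_sums(2)[OF h mem])
  also have "\<dots> = transform L a s * transform L b s"
    unfolding transform_def by (rule infsum_times[OF as bs])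
  finally show "transform L (conv L a b) s = transform L a s * transform L b s" .
qed

section \<open>Powers and absolutely convergent series in the weighted algebra\<close>

text \<open>A power is described only by its norm bound and its transform. This suffices for the
  sequel, where elements are identified through their transforms, and spares any associativity of
  \<open>conv\<close>.\<close>

lemma power_elem:
  assumes "nonneg_semigroup L" "weight_function L w" "a \<in> Aw L w"
  shows "\<exists>e\<in>Aw L w. wnorm L w e \<le> wnorm L w a ^ k \<and>
    (\<forall>s\<in>transform_domain L w. transform L e s = transform L a s ^ k)"
proof (induction k)
  case 0
  show ?case using unit_elem_facts[OF assms(1,2)] by (intro bexI[of _ unit_elem]) auto
next
  case (Suc k)
  then obtain e where e: "e \<in> Aw L w" "wnorm L w e \<le> wnorm L w a ^ k"
    "\<forall>s\<in>transform_domain L w. transform L e s = transform L a s ^ k" by blast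
  note c = conv_weighted[OF assms(1,2,3) e(1)]
  have "0 \<le> wnorm L w a"
    unfolding wnorm_def using assms(2)
    by (intro infsum_nonneg) (force simp: weight_function_def)
  then have "wnorm L w (conv L a e) \<le> wnorm L w a ^ Suc k"
    using c(2) mult_left_mono[OF e(2), of "wnorm L w a"] by auto
  then show ?case using c(1,3) e(3) by (intro bexI[of _ "conv L a e"]) auto
qed

text \<open>Completeness of the weighted algebra: the sum is taken pointwise, and absolute
  summability of the double family over \<open>UNIV \<times> L\<close> justifies interchanging it
  with the transform.\<close>

lemma series_elem:
  assumes w: "\<And>l. l \<in> L \<Longrightarrow> 0 < w l"
    and e: "\<And>k::nat. e k \<in> Aw L w" and N: "summable (\<lambda>k. wnorm L w (e k))"
  shows "\<exists>b\<in>Aw L w. \<forall>s\<in>transform_domain L w. (\<lambda>k. transform L (e k) s) sums transform L b s"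
proof -
  have nn: "0 \<le> wnorm L w (e k)" for k
    unfolding wnorm_def using w by (intro infsum_nonneg) (force intro: less_imp_le)
  let ?n = "\<lambda>(k, l). norm (e k l) * w l"
  have Nu: "(\<lambda>k. wnorm L w (e k)) summable_on UNIV"
    using N nn by (simp add: summable_on_UNIV_nonneg_real_iff)
  have n: "?n abs_summable_on UNIV \<times> L"
    unfolding Infinite_Sum.abs_summable_on_Sigma_iff
  proof (intro conjI ballI)
    show "(\<lambda>y. case (k, y) of (k, l) \<Rightarrow> norm (e k l) * w l) abs_summable_on L" for k
      unfolding prod.case by (rule summable_on_iff_abs_summable_on_real[THEN iffD1, OF Aw_D[OF e]])
    have "(\<Sum>\<^sub>\<infinity>y\<in>L. norm (case (k, y) of (k, l) \<Rightarrow> norm (e k l) * w l)) = wnorm L w (e k)" for k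
      unfolding wnorm_def by (rule infsum_cong) (use w in \<open>auto simp: abs_mult less_imp_le\<close>)
    then show "(\<lambda>x. \<Sum>\<^sub>\<infinity>y\<in>L. norm (case (x, y) of (k, l) \<Rightarrow> norm (e k l) * w l)) abs_summable_on UNIV"
      using summable_on_iff_abs_summable_on_real[THEN iffD1, OF Nu] by simp
  qed
  then have n': "(\<lambda>p. ?n (snd p, fst p)) abs_summable_on L \<times> UNIV"
    by (subst (asm) summable_on_reindex_bij_betw[symmetric, of "\<lambda>p. (snd p, fst p)" "L \<times> UNIV"])
      (auto intro!: bij_betwI[where g = "\<lambda>p. (snd p, fst p)"])
  then have n1: "\<And>l. l \<in> L \<Longrightarrow> (\<lambda>k. norm (e k l) * w l) abs_summable_on UNIV"
    and n2: "(\<lambda>l. \<Sum>\<^sub>\<infinity>k\<in>UNIV. norm (norm (e k l) * w l)) abs_summable_on L"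
    unfolding Infinite_Sum.abs_summable_on_Sigma_iff by simp_all
  have abs_e: "(\<lambda>k. e k l) abs_summable_on UNIV" if l: "l \<in> L" for l
    using summable_on_cmult_left[OF n1[OF l], of "1 / w l"] w[OF l]
    by (simp add: abs_mult)
  define b where "b l = (\<Sum>\<^sub>\<infinity>k\<in>UNIV. e k l)" for l
  have "(\<lambda>l. norm (b l) * w l) summable_on L"
  proof (rule summable_on_comparison_test)
    show "(\<lambda>l. \<Sum>\<^sub>\<infinity>k\<in>UNIV. norm (norm (e k l) * w l)) summable_on L"
      using n2 by (rule abs_summable_summable)
    fix l assume l: "l \<in> L"
    have "norm (b l) * w l \<le> (\<Sum>\<^sub>\<infinity>k\<in>UNIV. norm (e k l)) * w l"
      unfolding b_def by (intro mult_right_mono norm_infsum_bound abs_e l less_imp_le w)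
    then show "norm (b l) * w l \<le> (\<Sum>\<^sub>\<infinity>k\<in>UNIV. norm (norm (e k l) * w l))"
      using w[OF l] by (simp add: abs_mult infsum_cmult_left')
  qed (use w in \<open>simp add: less_imp_le\<close>)
  then have b: "b \<in> Aw L w" by (simp add: Aw_def)
  have "(\<lambda>k. transform L (e k) s) sums transform L b s" if s: "s \<in> transform_domain L w" for s
  proof -
    let ?f = "\<lambda>k l. e k l * exp (- dotc l s)"
    have "(\<lambda>p. ?f (fst p) (snd p)) abs_summable_on UNIV \<times> L"
      by (rule Infinite_Sum.abs_summable_on_comparison_test[OF n])
        (use s w in \<open>auto simp: norm_mult transform_domain_def less_imp_le intro!: mult_left_mono simp del: norm_exp_eq_Re\<close>)
    then have fs: "(\<lambda>(k, l). ?f k l) summable_on UNIV \<times> L"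
      by (simp add: abs_summable_summable case_prod_unfold)
    have "(\<lambda>k. transform L (e k) s) summable_on UNIV"
      using summable_on_Sigma_banach[OF fs] by (simp add: transform_def)
    moreover have "(\<Sum>\<^sub>\<infinity>k\<in>UNIV. transform L (e k) s) = transform L b s"
      unfolding transform_def b_def
      by (subst infsum_swap_banach[OF fs]) (simp add: infsum_cmult_left')
    ultimately have "((\<lambda>k. transform L (e k) s) has_sum transform L b s) UNIV"
      by (metis has_sum_infsum)
    then show ?thesis by (rule has_sum_imp_sums)
  qed
  with b show ?thesis by blast
qed

section \<open>Mean values and coefficient bounds\<close>

definition coord_sum :: "real ^ 'r \<Rightarrow> real" where
  "coord_sum l = (\<Sum>i\<in>UNIV. l $ i)"

text \<open>Restricting to points with all real parts equal leaves one complex variable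
  \<open>z\<close>: the transform becomes a Dirichlet series with frequencies
  \<open>coord_sum l\<close>, while the imaginary shift \<open>t\<close> contributes the phases
  \<open>l \<bullet> t\<close> that tell elements with equal \<open>coord_sum\<close> apart.\<close>

definition line :: "complex \<Rightarrow> real ^ 'r \<Rightarrow> complex ^ 'r" where
  "line z t = (\<chi> i. z + \<i> * of_real (t $ i))"

lemma coord_sum_add: "coord_sum (l + l') = coord_sum l + coord_sum l'"
  by (simp add: coord_sum_def sum.distrib)

lemma coord_sum_0 [simp]: "coord_sum 0 = 0"
  by (simp add: coord_sum_def)

lemma coord_sum_nonneg: "nonneg_semigroup L \<Longrightarrow> l \<in> L \<Longrightarrow> 0 \<le> coord_sum l"
  by (auto simp: nonneg_semigroup_def coord_sum_def intro: sum_nonneg)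

lemma dotc_line: "dotc l (line z t) = of_real (coord_sum l) * z + \<i> * of_real (l \<bullet> t)"
  by (simp add: dotc_def line_def coord_sum_def inner_vec_def algebra_simps sum.distrib sum_distrib_left)

lemma norm_exp_line: "norm (exp (- dotc l (line z t))) = exp (- (coord_sum l * Re z))"
  by (simp add: dotc_line)

lemma exp_weight:
  assumes "nonneg_semigroup L"
  shows "weight_function L (\<lambda>l. exp (- (coord_sum l * \<sigma>)))"
  by (simp add: weight_function_def coord_sum_def sum.distrib algebra_simps exp_add exp_diff exp_minus)

lemma line_in_transform_domain:
  assumes "nonneg_semigroup L" "\<sigma> \<le> Re z"
  shows "line z t \<in> transform_domain L (\<lambda>l. exp (- (coord_sum l * \<sigma>)))"
  using assms coord_sum_nonneg[OF assms(1)]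
  by (auto simp: transform_domain_def norm_exp_line intro!: mult_left_mono simp del: norm_exp_eq_Re)

section \<open>Recovering coefficients by averages over generic vertical translates\<close>

text \<open>Since \<open>d\<close> is nonzero, each excluded equation describes a hyperplane, hence
  a null set; countably many of them cannot cover the space.\<close>

lemma generic_vector:
  fixes S :: "'a::euclidean_space set"
  assumes "countable S" "0 \<notin> S"
  shows "\<exists>t. \<forall>d\<in>S. \<forall>n::int. d \<bullet> t \<noteq> 2 * pi * of_int n"
proof -
  have "countable ((\<lambda>(d, n::int). {t. d \<bullet> t = 2 * pi * of_int n}) ` (S \<times> UNIV))"
    using assms(1) by auto
  moreover have "negligible X" if "X \<in> (\<lambda>(d, n::int). {t. d \<bullet> t = 2 * pi * of_int n}) ` (S \<times> UNIV)" for X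
    using that assms(2) by (auto intro!: negligible_hyperplane)
  ultimately have "negligible (\<Union> ((\<lambda>(d, n::int). {t. d \<bullet> t = 2 * pi * of_int n}) ` (S \<times> UNIV)))"
    by (intro negligible_countable_Union) auto
  then have "\<Union> ((\<lambda>(d, n::int). {t. d \<bullet> t = 2 * pi * of_int n}) ` (S \<times> UNIV)) \<noteq> UNIV"
    by (metis non_negligible_UNIV)
  then show ?thesis by auto
qed

lemma cesaro_unimodular:
  fixes \<omega> :: complex
  assumes "norm \<omega> = 1" "\<omega> \<noteq> 1"
  shows "(\<lambda>N. (\<Sum>k<N. \<omega> ^ k) / of_nat N) \<longlonglongrightarrow> 0"
proof (rule Lim_null_comparison)
  have "(\<lambda>N. (2 / norm (\<omega> - 1)) * (1 / real N)) \<longlonglongrightarrow> (2 / norm (\<omega> - 1)) * 0"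
    by (intro tendsto_mult_left lim_1_over_n)
  then show "(\<lambda>N. (2 / norm (\<omega> - 1)) * (1 / real N)) \<longlonglongrightarrow> 0" by simp
  show "\<forall>\<^sub>F N in sequentially. norm ((\<Sum>k<N. \<omega> ^ k) / of_nat N) \<le> (2 / norm (\<omega> - 1)) * (1 / real N)"
  proof (rule always_eventually, rule allI)
    fix N
    have "norm (\<omega> ^ N - 1) \<le> 2"
      using norm_triangle_ineq4[of "\<omega> ^ N" 1] assms(1) by (simp add: norm_power)
    then have "norm (\<omega> ^ N - 1) / norm (\<omega> - 1) / real N \<le> 2 / norm (\<omega> - 1) / real N"
      by (intro divide_right_mono) auto
    then show "norm ((\<Sum>k<N. \<omega> ^ k) / of_nat N) \<le> (2 / norm (\<omega> - 1)) * (1 / real N)"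
      using assms(2) by (simp add: geometric_sum norm_divide norm_mult)
  qed
qed

text \<open>A finite set carries all but a small tail of \<open>d\<close>, and on it convergence is
  a matter of finitely many terms. The limit is required only where \<open>d\<close> is nonzero
  because a generic translate separates a frequency only from the support of the
  coefficients.\<close>

lemma infsum_dominated_convergence:
  fixes d \<gamma> :: "'a \<Rightarrow> 'b::{real_normed_div_algebra, banach}"
  assumes d: "d abs_summable_on L"
    and g: "\<And>N l. l \<in> L \<Longrightarrow> norm (g N l) \<le> 1" "\<And>l. l \<in> L \<Longrightarrow> norm (\<gamma> l) \<le> 1"
    and lim: "\<And>l. l \<in> L \<Longrightarrow> d l \<noteq> 0 \<Longrightarrow> (\<lambda>N. g N l) \<longlonglongrightarrow> \<gamma> l"
  shows "(\<lambda>N. \<Sum>\<^sub>\<infinity>l\<in>L. d l * g N l) \<longlonglongrightarrow> (\<Sum>\<^sub>\<infinity>l\<in>L. d l * \<gamma> l)"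
proof (rule LIMSEQ_I)
  fix e :: real assume e: "0 < e"
  \<comment> \<open>The tail costs at most \<open>2 * (e / 8)\<close>, as the multipliers differ by
    at most 2; the terms in \<open>F\<close> will cost less than \<open>e / 2\<close>.\<close>
  obtain F where F: "finite F" "F \<subseteq> L" "dist (\<Sum>l\<in>F. norm (d l)) (\<Sum>\<^sub>\<infinity>l\<in>L. norm (d l)) \<le> e / 8"
    using infsum_finite_approximation[OF d, of "e / 8"] e by auto
  have "(\<Sum>\<^sub>\<infinity>l\<in>L. norm (d l)) = (\<Sum>l\<in>F. norm (d l)) + (\<Sum>\<^sub>\<infinity>l\<in>L - F. norm (d l))"
    using infsum_Diff[OF d summable_on_finite[OF F(1)] F(2)] F(1) by simp
  then have tail: "(\<Sum>\<^sub>\<infinity>l\<in>L - F. norm (d l)) \<le> e / 8"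
    using F(3) by (simp add: dist_real_def)
  have "(\<lambda>N. \<Sum>l\<in>F. norm (d l) * norm (g N l - \<gamma> l)) \<longlonglongrightarrow> (\<Sum>l\<in>F. 0)"
  proof (rule tendsto_sum)
    fix l assume "l \<in> F"
    show "(\<lambda>N. norm (d l) * norm (g N l - \<gamma> l)) \<longlonglongrightarrow> 0"
    proof (cases "d l = 0")
      case False
      then have "(\<lambda>N. g N l - \<gamma> l) \<longlonglongrightarrow> 0"
        using lim[of l] \<open>l \<in> F\<close> F(2) by (simp add: subset_iff LIM_zero)
      then show ?thesis by (intro tendsto_mult_right_zero tendsto_norm_zero)
    qed auto
  qed
  then have "\<forall>\<^sub>F N in sequentially. (\<Sum>l\<in>F. norm (d l) * norm (g N l - \<gamma> l)) < e / 2"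
    by (rule order_tendstoD) (use e in simp)
  then obtain N0 where N0: "\<And>N. N \<ge> N0 \<Longrightarrow> (\<Sum>l\<in>F. norm (d l) * norm (g N l - \<gamma> l)) < e / 2"
    by (auto simp: eventually_sequentially)
  have s: "(\<lambda>l. norm (d l) * 2) summable_on L"
    using d by (rule summable_on_cmult_left)
  have le2: "norm (g N l - \<gamma> l) \<le> 2" if "l \<in> L" for N l
    using norm_triangle_ineq4[of "g N l" "\<gamma> l"] g(1)[OF that, of N] g(2)[OF that] by simp
  have dg: "(\<lambda>l. d l * h l) abs_summable_on L" if "\<And>l. l \<in> L \<Longrightarrow> norm (h l) \<le> 2" for h
    by (rule summable_on_comparison_test[OF s]) (use that in \<open>auto simp: norm_mult intro!: mult_left_mono\<close>)
  have "norm ((\<Sum>\<^sub>\<infinity>l\<in>L. d l * g N l) - (\<Sum>\<^sub>\<infinity>l\<in>L. d l * \<gamma> l)) < e" if "N \<ge> N0" for N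
  proof -
    have s1: "(\<lambda>l. d l * g N l) summable_on L" and s2: "(\<lambda>l. d l * \<gamma> l) summable_on L"
      by (rule abs_summable_summable, rule dg, use g in \<open>force intro: order_trans\<close>)+
    have s3: "(\<lambda>l. d l * (g N l - \<gamma> l)) abs_summable_on L"
      by (rule dg[OF le2])
    have "(\<Sum>\<^sub>\<infinity>l\<in>L. d l * g N l) - (\<Sum>\<^sub>\<infinity>l\<in>L. d l * \<gamma> l) = (\<Sum>\<^sub>\<infinity>l\<in>L. d l * (g N l - \<gamma> l))"
    proof -
      have "(\<Sum>\<^sub>\<infinity>l\<in>L. d l * g N l) = (\<Sum>\<^sub>\<infinity>l\<in>L. d l * (g N l - \<gamma> l) + d l * \<gamma> l)"
        by (simp add: algebra_simps)
      then show ?thesis using infsum_add[OF abs_summable_summable[OF s3] s2] by simp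
    qed
    then have "norm ((\<Sum>\<^sub>\<infinity>l\<in>L. d l * g N l) - (\<Sum>\<^sub>\<infinity>l\<in>L. d l * \<gamma> l))
        \<le> (\<Sum>\<^sub>\<infinity>l\<in>L. norm (d l * (g N l - \<gamma> l)))"
      using norm_infsum_bound[OF s3] by simp
    also have "\<dots> = (\<Sum>l\<in>F. norm (d l * (g N l - \<gamma> l))) + (\<Sum>\<^sub>\<infinity>l\<in>L - F. norm (d l * (g N l - \<gamma> l)))"
      using infsum_Diff[OF s3 summable_on_finite[OF F(1)] F(2)] F(1) by simp
    also have "(\<Sum>\<^sub>\<infinity>l\<in>L - F. norm (d l * (g N l - \<gamma> l))) \<le> (\<Sum>\<^sub>\<infinity>l\<in>L - F. norm (d l) * 2)"
    proof (rule infsum_mono)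
      show "(\<lambda>l. norm (d l * (g N l - \<gamma> l))) summable_on L - F"
        by (rule summable_on_subset_banach[OF s3]) auto
      show "(\<lambda>l. norm (d l) * 2) summable_on L - F"
        by (rule summable_on_subset_banach[OF s]) auto
    qed (use le2 in \<open>auto simp: norm_mult intro!: mult_left_mono\<close>)
    also have "\<dots> \<le> e / 4" using tail by (simp add: infsum_cmult_left')
    finally show ?thesis using N0[OF that] e by (simp add: norm_mult)
  qed
  then show "\<exists>N0. \<forall>N\<ge>N0. norm ((\<Sum>\<^sub>\<infinity>l\<in>L. d l * g N l) - (\<Sum>\<^sub>\<infinity>l\<in>L. d l * \<gamma> l)) < e"
    by blast
qed

lemma infsum_sum_lessThan:
  fixes f :: "nat \<Rightarrow> 'a \<Rightarrow> 'b::banach"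
  assumes "\<And>k. f k summable_on L"
  shows "(\<lambda>l. \<Sum>k<N. f k l) summable_on L \<and> (\<Sum>\<^sub>\<infinity>l\<in>L. \<Sum>k<N. f k l) = (\<Sum>k<N. infsum (f k) L)"
  by (induction N) (use assms in \<open>auto simp: infsum_add intro: summable_on_add\<close>)

text \<open>A discrete form of Bohr's mean value. Shifting by \<open>t\<close> and compensating the
  phase of \<open>l0\<close> multiplies the term at \<open>l\<close> by \<open>\<omega> l\<close>,
  which is 1 at \<open>l0\<close> and, on the rest of the support, a different unimodular number by
  the choice of \<open>t\<close>. Cesaro means therefore retain only the term at
  \<open>l0\<close>.\<close>

lemma transform_mean_value:
  assumes L: "nonneg_semigroup L" and c: "c \<in> Aw L (\<lambda>l. exp (- (coord_sum l * \<sigma>)))"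
    and l0: "l0 \<in> L" and z: "\<sigma> \<le> Re z"
    and t: "\<And>l n. l \<in> L \<Longrightarrow> c l \<noteq> 0 \<Longrightarrow> l \<noteq> l0 \<Longrightarrow> (l - l0) \<bullet> t \<noteq> 2 * pi * of_int n"
  shows "(\<lambda>N. (\<Sum>k<N. transform L c (line z (real k *\<^sub>R t)) * exp (\<i> * of_real (real k * (l0 \<bullet> t)))) / of_nat N)
    \<longlonglongrightarrow> c l0 * exp (- (of_real (coord_sum l0) * z))"
proof -
  define d where "d l = c l * exp (- (of_real (coord_sum l) * z))" for l
  define \<omega> where "\<omega> l = exp (- \<i> * of_real ((l - l0) \<bullet> t))" for l
  have nw: "norm (\<omega> l) = 1" for l by (simp add: \<omega>_def)
  have ds: "d abs_summable_on L"
    using transform_abs_summable[OF c line_in_transform_domain[OF L z, of 0]] by (simp add: d_def dotc_line)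
  have dws: "(\<lambda>l. d l * \<omega> l ^ k) summable_on L" for k
    by (rule abs_summable_summable, rule Infinite_Sum.abs_summable_on_comparison_test[OF ds])
      (simp add: norm_mult norm_power nw)
  have average_term: "transform L c (line z (real k *\<^sub>R t)) * exp (\<i> * of_real (real k * (l0 \<bullet> t)))
      = (\<Sum>\<^sub>\<infinity>l\<in>L. d l * \<omega> l ^ k)" for k
    unfolding transform_def infsum_cmult_left'[symmetric]
    by (rule infsum_cong)
      (simp add: d_def \<omega>_def dotc_line exp_of_nat_mult[symmetric] exp_add[symmetric] mult.assoc inner_diff_left algebra_simps)
  have avg: "(\<Sum>k<N. transform L c (line z (real k *\<^sub>R t)) * exp (\<i> * of_real (real k * (l0 \<bullet> t)))) / of_nat N
      = (\<Sum>\<^sub>\<infinity>l\<in>L. d l * ((\<Sum>k<N. \<omega> l ^ k) / of_nat N))" for N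
  proof -
    have "(\<Sum>k<N. transform L c (line z (real k *\<^sub>R t)) * exp (\<i> * of_real (real k * (l0 \<bullet> t)))) / of_nat N
      = (\<Sum>\<^sub>\<infinity>l\<in>L. \<Sum>k<N. d l * \<omega> l ^ k) * (1 / of_nat N)"
      unfolding average_term using infsum_sum_lessThan[of "\<lambda>k l. d l * \<omega> l ^ k", OF dws] by simp
    also have "\<dots> = (\<Sum>\<^sub>\<infinity>l\<in>L. (\<Sum>k<N. d l * \<omega> l ^ k) * (1 / of_nat N))"
      by (simp only: infsum_cmult_left')
    finally show ?thesis by (simp add: sum_distrib_left)
  qed
  have "(\<lambda>N. \<Sum>\<^sub>\<infinity>l\<in>L. d l * ((\<Sum>k<N. \<omega> l ^ k) / of_nat N))
      \<longlonglongrightarrow> (\<Sum>\<^sub>\<infinity>l\<in>L. d l * (if l = l0 then 1 else 0))"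
  proof (rule infsum_dominated_convergence[OF ds])
    show "norm ((\<Sum>k<N. \<omega> l ^ k) / of_nat N) \<le> 1" for N l
    proof -
      have "norm (\<Sum>k<N. \<omega> l ^ k) \<le> (\<Sum>k<N. 1)"
        by (rule sum_norm_le) (simp add: norm_power nw)
      then show ?thesis by (simp add: norm_divide divide_simps)
    qed
    show "(\<lambda>N. (\<Sum>k<N. \<omega> l ^ k) / of_nat N) \<longlonglongrightarrow> (if l = l0 then 1 else 0)"
      if "l \<in> L" "d l \<noteq> 0" for l
    proof (cases "l = l0")
      case True
      \<comment> \<open>The averages equal 1 only from \<open>N = 1\<close> on; for
        \<open>N = 0\<close> the quotient is 0.\<close>
      have "(\<lambda>N. (\<Sum>k<N. \<omega> l ^ k) / of_nat N) \<longlonglongrightarrow> 1"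
        by (rule tendsto_eventually, rule eventually_sequentiallyI[of 1]) (simp add: True \<omega>_def)
      then show ?thesis using True by simp
    next
      case False
      have "\<omega> l \<noteq> 1"
      proof
        assume "\<omega> l = 1"
        then obtain n :: int where "- ((l - l0) \<bullet> t) = of_int (2 * n) * pi"
          by (auto simp: \<omega>_def exp_eq_1)
        then have "(l - l0) \<bullet> t = 2 * pi * of_int (- n)" by (simp add: mult_ac)
        then show False using t[OF that(1) _ False, of "- n"] that(2) by (simp add: d_def)
      qed
      then show ?thesis using cesaro_unimodular[OF nw] False by simp
    qed
  qed auto
  also have "(\<Sum>\<^sub>\<infinity>l\<in>L. d l * (if l = l0 then 1 else 0)) = (\<Sum>\<^sub>\<infinity>l\<in>{l0}. d l)"
    by (rule infsum_cong_neutral) (use l0 in auto)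
  finally show ?thesis unfolding avg by (simp add: d_def)
qed

text \<open>Summability makes the support of \<open>c\<close> countable, so the nonzero differences
  from \<open>l0\<close> form a countable set to which \<open>generic_vector\<close>
  applies.\<close>

lemma separating_vector:
  assumes "c \<in> Aw L (\<lambda>l. exp (- (coord_sum l * \<sigma>)))"
  obtains t :: "real ^ 'r" where
    "\<And>l n. l \<in> L \<Longrightarrow> c l \<noteq> 0 \<Longrightarrow> l \<noteq> l0 \<Longrightarrow> (l - l0) \<bullet> t \<noteq> 2 * pi * of_int n"
proof -
  have "countable {l\<in>L. norm (c l) * exp (- (coord_sum l * \<sigma>)) \<noteq> 0}"
    by (rule summable_countable_real[OF Aw_D[OF assms]])
  then have "countable ((\<lambda>l. l - l0) ` ({l\<in>L. c l \<noteq> 0} - {l0}))" by simp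
  from generic_vector[OF this] obtain t
    where "\<forall>d\<in>(\<lambda>l. l - l0) ` ({l\<in>L. c l \<noteq> 0} - {l0}). \<forall>n::int. d \<bullet> t \<noteq> 2 * pi * of_int n"
    by fastforce
  then show ?thesis by (intro that[of t]) simp
qed

text \<open>Uniqueness of Dirichlet coefficients: the mean value of the zero function is the
  coefficient times a nonvanishing exponential.\<close>

lemma transform_eq_zeroD:
  assumes L: "nonneg_semigroup L" and c: "c \<in> Aw L (\<lambda>l. exp (- (coord_sum l * \<sigma>)))"
    and zero: "\<And>z t. \<sigma> \<le> Re z \<Longrightarrow> transform L c (line z t) = 0" and l: "l \<in> L"
  shows "c l = 0"
proof -
  obtain t where t: "\<And>l' n. l' \<in> L \<Longrightarrow> c l' \<noteq> 0 \<Longrightarrow> l' \<noteq> l \<Longrightarrow> (l' - l) \<bullet> t \<noteq> 2 * pi * of_int n"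
    using separating_vector[OF c] by metis
  have "(\<lambda>N. 0) \<longlonglongrightarrow> c l * exp (- (of_real (coord_sum l) * of_real \<sigma>))"
    using transform_mean_value[OF L c l _ t, of "of_real \<sigma>"] zero by simp
  from LIMSEQ_unique[OF this tendsto_const] show ?thesis by simp
qed

text \<open>The series of \<open>c\<close> is known to converge only for
  \<open>\<sigma> \<le> Re z\<close>, yet the averages of \<open>\<Phi>\<close> are holomorphic and
  bounded by \<open>B\<close> on the larger half-plane. Montel's theorem gives a limit
  \<open>g\<close> there, the identity theorem identifies it with the single term at
  \<open>l\<close>, and evaluation at \<open>x\<close> bounds that term. A negative \<open>x\<close>
  turns boundedness across the imaginary axis into exponential decay.\<close>

lemma coefficient_bound:
  assumes L: "nonneg_semigroup L" and c: "c \<in> Aw L (\<lambda>l. exp (- (coord_sum l * \<sigma>)))"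
    and eps: "- \<epsilon> < \<sigma>"
    and hol: "\<And>t. (\<lambda>z. \<Phi> (line z t)) holomorphic_on {z. - \<epsilon> < Re z}"
    and bd: "\<And>z t. - \<epsilon> < Re z \<Longrightarrow> norm (\<Phi> (line z t)) \<le> B"
    and eq: "\<And>z t. \<sigma> \<le> Re z \<Longrightarrow> transform L c (line z t) = \<Phi> (line z t)"
    and l: "l \<in> L" and x: "- \<epsilon> < x"
  shows "norm (c l) \<le> B * exp (coord_sum l * x)"
proof -
  obtain t where t: "\<And>l' n. l' \<in> L \<Longrightarrow> c l' \<noteq> 0 \<Longrightarrow> l' \<noteq> l \<Longrightarrow> (l' - l) \<bullet> t \<noteq> 2 * pi * of_int n"
    using separating_vector[OF c] by metis
  let ?S = "{z. - \<epsilon> < Re z}"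
  define G where "G N z = (\<Sum>k<N. \<Phi> (line z (real k *\<^sub>R t)) * exp (\<i> * of_real (real k * (l \<bullet> t)))) / of_nat N"
    for N :: nat and z
  \<comment> \<open>Needed for the average with \<open>N = 0\<close>, which is 0 by the convention
    for division.\<close>
  have B: "0 \<le> B"
    using bd[of "of_real \<sigma>" 0] eps order_trans[OF norm_ge_zero] by simp blast
  have opS: "open ?S" by (rule open_halfspace_Re_gt)
  have Gh: "G N holomorphic_on ?S" for N
    unfolding G_def by (cases "N = 0") (auto intro!: holomorphic_intros hol)
  have GB: "norm (G N z) \<le> B" if "z \<in> ?S" for N z
  proof -
    have "norm (\<Sum>k<N. \<Phi> (line z (real k *\<^sub>R t)) * exp (\<i> * of_real (real k * (l \<bullet> t)))) \<le> (\<Sum>k<N. B)"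
      by (rule sum_norm_le) (use bd that in \<open>simp add: norm_mult\<close>)
    then show ?thesis using B by (cases "N = 0") (simp_all add: G_def norm_divide divide_simps mult.commute)
  qed
  obtain g r where g: "g holomorphic_on ?S" "strict_mono (r :: nat \<Rightarrow> nat)"
    "\<And>z. z \<in> ?S \<Longrightarrow> (\<lambda>n. G (r n) z) \<longlonglongrightarrow> g z"
  proof (rule Montel[of ?S "{h. h holomorphic_on ?S \<and> (\<forall>z\<in>?S. norm (h z) \<le> B)}" G])
    show "\<exists>B'. \<forall>h\<in>{h. h holomorphic_on ?S \<and> (\<forall>z\<in>?S. norm (h z) \<le> B)}. \<forall>z\<in>K. norm (h z) \<le> B'"
      if "K \<subseteq> ?S" for K
      using that by (intro exI[of _ B]) auto
    show "range G \<subseteq> {h. h holomorphic_on ?S \<and> (\<forall>z\<in>?S. norm (h z) \<le> B)}"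
      using Gh GB by auto
  qed (use opS in auto)
  have conn: "connected ?S"
    by (intro convex_connected convex_halfspace_Re_gt)
  have "g (of_real x) = c l * exp (- (of_real (coord_sum l) * of_real x))"
  proof (rule analytic_continuation_open[of "{z. \<sigma> < Re z}" ?S g])
    show "open {z. \<sigma> < Re z}" by (rule open_halfspace_Re_gt)
    show "{z. \<sigma> < Re z} \<noteq> {}" by (auto intro!: exI[of _ "of_real (\<sigma> + 1)"])
    show "(\<lambda>z. c l * exp (- (of_real (coord_sum l) * z))) holomorphic_on ?S"
      by (intro holomorphic_intros)
    fix z assume "z \<in> {z. \<sigma> < Re z}"
    then have z: "\<sigma> \<le> Re z" "z \<in> ?S" using eps by auto
    have "(\<lambda>N. G N z) \<longlonglongrightarrow> c l * exp (- (of_real (coord_sum l) * z))"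
      using transform_mean_value[OF L c l z(1) t] by (simp add: eq[OF z(1)] G_def)
    from LIMSEQ_subseq_LIMSEQ[OF this g(2)] have "(\<lambda>n. G (r n) z) \<longlonglongrightarrow> c l * exp (- (of_real (coord_sum l) * z))"
      by (simp add: o_def)
    then show "g z = c l * exp (- (of_real (coord_sum l) * z))"
      using g(3)[OF z(2)] LIMSEQ_unique by blast
  qed (use opS conn g(1) eps x in auto)
  moreover have "norm (g (of_real x)) \<le> B"
    by (rule Lim_bounded[OF tendsto_norm[OF g(3)], of _ 0]) (use GB x in auto)
  ultimately have "norm (c l) * exp (- (coord_sum l * x)) \<le> B"
    by (simp add: norm_mult)
  then show ?thesis by (simp add: exp_minus divide_simps)
qed

section \<open>Finitely generated semigroups\<close>

text \<open>For finite \<open>F\<close> this is the additive monoid generated by \<open>F\<close>.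
  Multiplicity functions make it easy to split off one generator.\<close>

definition semigroup_hull :: "(real ^ 'r) set \<Rightarrow> (real ^ 'r) set" where
  "semigroup_hull F = range (\<lambda>n :: real ^ 'r \<Rightarrow> nat. \<Sum>x\<in>F. real (n x) *\<^sub>R x)"

lemma sum_in_semigroup_hull: "(\<Sum>x\<in>F. real (n x) *\<^sub>R x) \<in> semigroup_hull F"
  unfolding semigroup_hull_def by (rule rangeI)

lemma scaleR_nat_mem:
  assumes "nonneg_semigroup L" "x \<in> L"
  shows "real n *\<^sub>R x \<in> L"
  by (induction n) (use assms in \<open>auto simp: nonneg_semigroup_def scaleR_left_distrib\<close>)

lemma sum_mem_semigroup:
  assumes "nonneg_semigroup L" "\<And>x. x \<in> F \<Longrightarrow> f x \<in> L"
  shows "sum f F \<in> L"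
  using assms(2) by (induction F rule: infinite_finite_induct) (use assms(1) in \<open>auto simp: nonneg_semigroup_def\<close>)

lemma semigroup_hull_subset:
  assumes "nonneg_semigroup L" "F \<subseteq> L"
  shows "semigroup_hull F \<subseteq> L"
  unfolding semigroup_hull_def using assms by (auto intro!: sum_mem_semigroup scaleR_nat_mem)

lemma subset_semigroup_hull:
  assumes "finite F"
  shows "F \<subseteq> semigroup_hull F"
proof
  fix y assume y: "y \<in> F"
  have "(\<Sum>x\<in>F. real (if x = y then 1 else 0) *\<^sub>R x) = (\<Sum>x\<in>F. if x = y then x else 0)"
    by (rule sum.cong) auto
  also have "\<dots> = y" using assms y by simp
  finally show "y \<in> semigroup_hull F"
    using sum_in_semigroup_hull[of "\<lambda>x. if x = y then 1 else 0" F] by (rule subst)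
qed

lemma semigroup_hull_semigroup:
  assumes "nonneg_semigroup L" "F \<subseteq> L"
  shows "nonneg_semigroup (semigroup_hull F)"
  unfolding nonneg_semigroup_def
proof (intro conjI ballI)
  show "0 \<in> semigroup_hull F" using sum_in_semigroup_hull[of "\<lambda>_. 0" F] by simp
  show "x + y \<in> semigroup_hull F" if "x \<in> semigroup_hull F" "y \<in> semigroup_hull F" for x y
  proof -
    from that obtain m n where "x = (\<Sum>x\<in>F. real (m x) *\<^sub>R x)" "y = (\<Sum>x\<in>F. real (n x) *\<^sub>R x)"
      by (auto simp: semigroup_hull_def)
    then have "x + y = (\<Sum>x\<in>F. real (m x + n x) *\<^sub>R x)"
      by (simp add: sum.distrib scaleR_left_distrib)
    then show ?thesis using sum_in_semigroup_hull[of "\<lambda>x. m x + n x" F] by (simp only:)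
  qed
  show "\<forall>i. 0 \<le> x $ i" if "x \<in> semigroup_hull F" for x
    using semigroup_hull_subset[OF assms] that assms(1) by (auto simp: nonneg_semigroup_def)
qed

lemma semigroup_hull_insert:
  assumes "finite F" "x \<notin> F"
  shows "semigroup_hull (insert x F) \<subseteq> (\<lambda>(n, g). real n *\<^sub>R x + g) ` (UNIV \<times> semigroup_hull F)"
proof
  fix y assume "y \<in> semigroup_hull (insert x F)"
  then obtain n where "y = (\<Sum>x\<in>insert x F. real (n x) *\<^sub>R x)" by (auto simp: semigroup_hull_def)
  then have "y = real (n x) *\<^sub>R x + (\<Sum>x\<in>F. real (n x) *\<^sub>R x)"
    using assms by simp
  then show "y \<in> (\<lambda>(n, g). real n *\<^sub>R x + g) ` (UNIV \<times> semigroup_hull F)"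
    by (force simp: semigroup_hull_def)
qed

text \<open>The map need not be injective, since an element may have several representations by
  generators. Choosing one preimage for each value only passes to a subfamily.\<close>

lemma summable_on_image:
  fixes f :: "'a \<Rightarrow> 'b::banach"
  assumes "(\<lambda>x. f (h x)) summable_on A"
  shows "f summable_on h ` A"
proof -
  obtain B where B: "B \<subseteq> A" "inj_on h B" "h ` A = h ` B"
    using subset_image_inj[of "h ` A" h A] by auto
  have "(f \<circ> h) summable_on B"
    using summable_on_subset_banach[OF assms B(1)] by (simp add: o_def)
  then show ?thesis using B by (simp add: summable_on_reindex)
qed

text \<open>Induction on the generators: \<open>real n *\<^sub>R x + g\<close> parametrizes the hull
  of \<open>insert x F\<close>, and submultiplicativity dominates \<open>f\<close> there by the
  product of two summable families.\<close>

lemma semigroup_hull_summable: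
  fixes f :: "real ^ 'r \<Rightarrow> real"
  assumes "finite F" "F \<subseteq> L" and L: "nonneg_semigroup L"
    and nn: "\<And>l. l \<in> L \<Longrightarrow> 0 \<le> f l"
    and sub: "\<And>l l'. l \<in> L \<Longrightarrow> l' \<in> L \<Longrightarrow> f (l + l') \<le> f l * f l'"
    and s: "\<And>x. x \<in> F \<Longrightarrow> (\<lambda>n. f (real n *\<^sub>R x)) summable_on UNIV"
  shows "f summable_on semigroup_hull F"
  using assms(1,2) s
proof (induction F)
  case empty
  have "finite (semigroup_hull {})" by (simp add: semigroup_hull_def)
  then show ?case by (rule summable_on_finite)
next
  case (insert x F)
  have 1: "(\<lambda>n. f (real n *\<^sub>R x)) abs_summable_on UNIV" and 2: "f abs_summable_on semigroup_hull F"
    by (rule summable_on_iff_abs_summable_on_real[THEN iffD1], use insert in simp)+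
  have mem: "real n *\<^sub>R x \<in> L" "g \<in> L" if "g \<in> semigroup_hull F" for n g
    using that insert.prems(1) semigroup_hull_subset[OF L, of F] scaleR_nat_mem[OF L] by auto
  have "(\<lambda>(n, g). f (real n *\<^sub>R x) * f g) summable_on UNIV \<times> semigroup_hull F"
    by (rule abs_summable_summable[OF abs_summable_times[OF 1 2]])
  then have "(\<lambda>p. f (case p of (n, g) \<Rightarrow> real n *\<^sub>R x + g)) summable_on UNIV \<times> semigroup_hull F"
    by (rule summable_on_comparison_test)
      (use mem L in \<open>auto simp: nonneg_semigroup_def intro!: nn sub\<close>)
  then have "f summable_on (\<lambda>(n, g). real n *\<^sub>R x + g) ` (UNIV \<times> semigroup_hull F)"
    by (rule summable_on_image)
  then show ?case
    by (rule summable_on_subset_banach[OF _ semigroup_hull_insert[OF insert.hyps]])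
qed

lemma coord_sum_pos:
  assumes "nonneg_semigroup L" "l \<in> L" "l \<noteq> 0"
  shows "0 < coord_sum l"
proof -
  have "coord_sum l \<noteq> 0"
    using assms unfolding coord_sum_def nonneg_semigroup_def
    by (subst sum_nonneg_eq_0_iff) (auto simp: vec_eq_iff)
  then show ?thesis using coord_sum_nonneg[OF assms(1,2)] by simp
qed

lemma coord_sum_scaleR: "coord_sum (c *\<^sub>R l) = c * coord_sum l"
  by (simp add: coord_sum_def sum_distrib_left)

text \<open>The root condition in admissibility says that \<open>w\<close> grows subexponentially
  along the multiples of \<open>l\<close>, so any exponential decay defeats it.\<close>

lemma admissible_decay_summable:
  assumes L: "nonneg_semigroup L" and w: "admissible_weight L w" and l: "l \<in> L" "l \<noteq> 0" and "0 < \<epsilon>"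
  shows "(\<lambda>n. exp (- (coord_sum (real n *\<^sub>R l) * \<epsilon>)) * w (real n *\<^sub>R l)) summable_on UNIV"
proof -
  \<comment> \<open>Half of the decay rate: the full exponential is \<open>r ^ k * r ^ k\<close>.
    One factor absorbs the eventual bound \<open>(1 / r) ^ k\<close> for the weight, and the other
    is left as a convergent geometric series.\<close>
  define r where "r = exp (- (coord_sum l * \<epsilon> / 2))"
  have cl: "0 < coord_sum l * \<epsilon> / 2" using coord_sum_pos[OF L l] \<open>0 < \<epsilon>\<close> by simp
  then have r: "0 < r" "r < 1" by (simp_all add: r_def)
  have w0: "0 < w (real n *\<^sub>R l)" for n
    using w scaleR_nat_mem[OF L l(1)] by (simp add: admissible_weight_def weight_function_def)
  have "(\<lambda>k. w (real k *\<^sub>R l) powr (1 / real k)) \<longlonglongrightarrow> 1"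
    using w l(1) by (simp add: admissible_weight_def)
  then have "\<forall>\<^sub>F k in sequentially. w (real k *\<^sub>R l) powr (1 / real k) < 1 / r"
    by (rule order_tendstoD) (use r in simp)
  then have ev: "\<forall>\<^sub>F k in sequentially. norm (exp (- (coord_sum (real k *\<^sub>R l) * \<epsilon>)) * w (real k *\<^sub>R l)) \<le> r ^ k"
    using eventually_gt_at_top[of 0]
  proof eventually_elim
    case (elim k)
    have "w (real k *\<^sub>R l) = (w (real k *\<^sub>R l) powr (1 / real k)) powr real k"
      using elim w0[of k] by (simp add: powr_powr)
    also have "\<dots> \<le> (1 / r) powr real k"
      by (rule powr_mono2) (use elim in auto)
    also have "\<dots> = (1 / r) ^ k" using r by (simp add: powr_realpow)
    finally have le: "w (real k *\<^sub>R l) \<le> (1 / r) ^ k" .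
    have "exp (- (coord_sum (real k *\<^sub>R l) * \<epsilon>)) = (r ^ k) * (r ^ k)"
      by (simp add: r_def coord_sum_scaleR exp_of_nat_mult[symmetric] exp_add[symmetric] field_simps)
    then have "exp (- (coord_sum (real k *\<^sub>R l) * \<epsilon>)) * w (real k *\<^sub>R l) \<le> (r ^ k) * (r ^ k) * (1 / r) ^ k"
      using mult_left_mono[OF le, of "r ^ k * r ^ k"] r by simp
    also have "\<dots> = r ^ k" using r by (simp add: power_one_over)
    finally show ?case using w0[of k] by (simp add: abs_mult)
  qed
  have "summable (\<lambda>k. exp (- (coord_sum (real k *\<^sub>R l) * \<epsilon>)) * w (real k *\<^sub>R l))"
    by (rule summable_comparison_test_ev[OF ev]) (use r in \<open>simp add: summable_geometric\<close>)
  then show ?thesis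
    using w0 by (simp add: summable_on_UNIV_nonneg_real_iff less_imp_le)
qed

lemma semigroup_hull_decay_summable:
  assumes L: "nonneg_semigroup L" and w: "admissible_weight L w" and F: "finite F" "F \<subseteq> L - {0}" and "0 < \<epsilon>"
  shows "(\<lambda>l. exp (- (coord_sum l * \<epsilon>)) * w l) summable_on semigroup_hull F"
proof (rule semigroup_hull_summable[OF F(1) _ L])
  show "F \<subseteq> L" using F(2) by auto
  show "0 \<le> exp (- (coord_sum l * \<epsilon>)) * w l" if "l \<in> L" for l
    using w that by (simp add: admissible_weight_def weight_function_def less_imp_le)
  show "exp (- (coord_sum (l + l') * \<epsilon>)) * w (l + l')
      \<le> exp (- (coord_sum l * \<epsilon>)) * w l * (exp (- (coord_sum l' * \<epsilon>)) * w l')" if "l \<in> L" "l' \<in> L" for l l'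
  proof -
    have "w (l + l') \<le> w l * w l'"
      using w that by (simp add: admissible_weight_def weight_function_def)
    from mult_left_mono[OF this, of "exp (- (coord_sum (l + l') * \<epsilon>))"] show ?thesis
      by (simp add: coord_sum_add ring_distribs exp_add exp_diff exp_minus field_simps)
  qed
  show "(\<lambda>n. exp (- (coord_sum (real n *\<^sub>R x) * \<epsilon>)) * w (real n *\<^sub>R x)) summable_on UNIV" if "x \<in> F" for x
    using admissible_decay_summable[OF L w _ _ \<open>0 < \<epsilon>\<close>] that F(2) by auto
qed

section \<open>Inverting finitely supported elements\<close>

lemma line_Hr: "0 < Re z \<Longrightarrow> line z t \<in> Hr"
  by (simp add: line_def Hr_def)

text \<open>With finitely many frequencies, a shift by a small \<open>e\<close> changes the sum by
  less than \<open>\<delta> - \<eta>\<close>, uniformly in \<open>z\<close> and \<open>t\<close>.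
  Points slightly left of the imaginary axis are compared with their shifts into
  \<open>Hr\<close>.\<close>

lemma extended_lower_bound:
  fixes p :: "real ^ 'r \<Rightarrow> complex"
  assumes L: "nonneg_semigroup L" and F: "finite F" "F \<subseteq> L"
    and lower: "\<And>s. s \<in> Hr \<Longrightarrow> \<delta> \<le> norm (\<Sum>l\<in>F. p l * exp (- dotc l s))" and "\<eta> < \<delta>"
  shows "\<exists>\<epsilon>>0. \<forall>z t. - \<epsilon> < Re z \<longrightarrow> \<eta> \<le> norm (\<Sum>l\<in>F. p l * exp (- dotc l (line z t)))"
proof -
  have "((\<lambda>e. \<Sum>l\<in>F. norm (p l) * (exp (coord_sum l * e) - 1)) \<longlongrightarrow> (\<Sum>l\<in>F. norm (p l) * (exp (coord_sum l * 0) - 1))) (at_right 0)"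
    by (intro tendsto_intros)
  then have "\<forall>\<^sub>F e in at_right 0. (\<Sum>l\<in>F. norm (p l) * (exp (coord_sum l * e) - 1)) < \<delta> - \<eta>"
    by (rule order_tendstoD) (use \<open>\<eta> < \<delta>\<close> in simp)
  then have "\<forall>\<^sub>F e in at_right 0. 0 < e \<and> (\<Sum>l\<in>F. norm (p l) * (exp (coord_sum l * e) - 1)) < \<delta> - \<eta>"
    using eventually_at_right_less[of "0 :: real"] by eventually_elim simp
  then obtain e where e: "0 < e" "(\<Sum>l\<in>F. norm (p l) * (exp (coord_sum l * e) - 1)) < \<delta> - \<eta>"
    by (metis (mono_tags, lifting) eventually_happens trivial_limit_at_right_real)
  let ?P = "\<lambda>s. \<Sum>l\<in>F. p l * exp (- dotc l s)"
  have "\<eta> \<le> norm (?P (line z t))" if z: "- e < Re z" for z t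
  proof -
    \<comment> \<open>The shifted point has positive real part, so the lower bound applies to it and
      its exponentials have modulus at most 1.\<close>
    let ?z = "z + of_real e"
    have diff: "norm (p l * exp (- dotc l (line ?z t)) - p l * exp (- dotc l (line z t)))
        \<le> norm (p l) * (exp (coord_sum l * e) - 1)" if "l \<in> F" for l
    proof -
      have cs: "0 \<le> coord_sum l" using coord_sum_nonneg[OF L] that F by auto
      have "exp (- dotc l (line z t)) = exp (- dotc l (line ?z t)) * of_real (exp (coord_sum l * e))"
        by (simp add: dotc_line exp_add[symmetric] exp_of_real[symmetric] algebra_simps)
      then have "p l * exp (- dotc l (line ?z t)) - p l * exp (- dotc l (line z t))
          = p l * exp (- dotc l (line ?z t)) * of_real (1 - exp (coord_sum l * e))"
        by (simp add: algebra_simps)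
      then have "norm (p l * exp (- dotc l (line ?z t)) - p l * exp (- dotc l (line z t)))
          = norm (p l) * exp (- (coord_sum l * Re ?z)) * (exp (coord_sum l * e) - 1)"
        using cs e(1) by (simp only: norm_mult norm_exp_line norm_of_real) simp
      also have "\<dots> \<le> norm (p l) * 1 * (exp (coord_sum l * e) - 1)"
        using cs e(1) z by (intro mult_right_mono mult_left_mono) auto
      finally show ?thesis by simp
    qed
    have "norm (?P (line ?z t) - ?P (line z t)) \<le> (\<Sum>l\<in>F. norm (p l) * (exp (coord_sum l * e) - 1))"
      unfolding sum_subtractf[symmetric] by (rule sum_norm_le[OF diff])
    moreover have "\<delta> \<le> norm (?P (line ?z t))"
      by (rule lower[OF line_Hr]) (use z in simp)
    ultimately show ?thesis
      using e(2) norm_triangle_ineq2[of "?P (line ?z t)" "?P (line z t)"] by linarith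
  qed
  with e(1) show ?thesis by blast
qed

lemma tendsto_decay_sum:
  fixes c :: "real ^ 'r \<Rightarrow> 'b::real_normed_vector"
  assumes L: "nonneg_semigroup L" and F: "F \<subseteq> L - {0}"
  shows "((\<lambda>\<sigma>. \<Sum>l\<in>F. exp (- (coord_sum l * \<sigma>)) *\<^sub>R c l) \<longlongrightarrow> 0) at_top"
proof (rule tendsto_null_sum)
  fix l assume "l \<in> F"
  then have "0 < coord_sum l" using coord_sum_pos[OF L] F by auto
  then have "filterlim (\<lambda>\<sigma>. coord_sum l * \<sigma>) at_top at_top"
    by (intro filterlim_tendsto_pos_mult_at_top[OF tendsto_const] filterlim_ident)
  then have "((\<lambda>\<sigma>. exp (- (coord_sum l * \<sigma>))) \<longlongrightarrow> 0) at_top"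
    by (intro filterlim_compose[OF exp_at_bot] filterlim_compose[OF filterlim_uminus_at_bot_at_top])
  then have "((\<lambda>\<sigma>. exp (- (coord_sum l * \<sigma>)) *\<^sub>R c l) \<longlongrightarrow> 0 *\<^sub>R c l) at_top"
    by (intro tendsto_scaleR tendsto_const)
  then show "((\<lambda>\<sigma>. exp (- (coord_sum l * \<sigma>)) *\<^sub>R c l) \<longlongrightarrow> 0) at_top" by simp
qed

text \<open>Along \<open>(\<sigma>, ..., \<sigma>)\<close> with real \<open>\<sigma>\<close> tending
  to infinity every term except the one at 0 vanishes, so the lower bound passes to the limit
  \<open>p 0\<close>.\<close>

lemma constant_term_bound:
  fixes p :: "real ^ 'r \<Rightarrow> complex"
  assumes L: "nonneg_semigroup L" and F: "finite F" "0 \<in> F" "F \<subseteq> L"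
    and lower: "\<And>s. s \<in> Hr \<Longrightarrow> \<delta> \<le> norm (\<Sum>l\<in>F. p l * exp (- dotc l s))"
  shows "\<delta> \<le> norm (p 0)"
proof -
  have eq: "(\<Sum>l\<in>F. p l * exp (- dotc l (line (of_real \<sigma>) 0)))
      = p 0 + (\<Sum>l\<in>F - {0}. exp (- (coord_sum l * \<sigma>)) *\<^sub>R p l)" for \<sigma>
    using F(1,2) by (simp add: sum.remove dotc_line scaleR_conv_of_real exp_of_real[symmetric] mult.commute)
  have "((\<lambda>\<sigma>. \<Sum>l\<in>F. p l * exp (- dotc l (line (of_real \<sigma>) 0))) \<longlongrightarrow> p 0 + 0) at_top"
    unfolding eq by (intro tendsto_add tendsto_const tendsto_decay_sum[OF L]) (use F(3) in auto)
  then have "((\<lambda>\<sigma>. norm (\<Sum>l\<in>F. p l * exp (- dotc l (line (of_real \<sigma>) 0)))) \<longlongrightarrow> norm (p 0)) at_top"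
    by (intro tendsto_norm) simp
  moreover have "\<forall>\<^sub>F \<sigma> in at_top. \<delta> \<le> norm (\<Sum>l\<in>F. p l * exp (- dotc l (line (of_real \<sigma>) 0)))"
    using eventually_gt_at_top[of 0] by eventually_elim (intro lower line_Hr, simp)
  ultimately show ?thesis
    by (rule tendsto_lowerbound) simp
qed

text \<open>After division by \<open>p 0\<close> the element is \<open>unit_elem - y\<close> with
  \<open>y\<close> vanishing at 0. The exponentially weighted norm of \<open>y\<close> tends to 0 as
  \<open>\<sigma>\<close> grows, so the geometric series in \<open>y\<close> converges for a
  suitable \<open>\<sigma>\<close>.\<close>

lemma neumann_inverse:
  fixes p :: "real ^ 'r \<Rightarrow> complex"
  assumes G: "nonneg_semigroup G" and F: "finite F" "0 \<in> F" "F \<subseteq> G"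
    and p: "\<And>l. l \<notin> F \<Longrightarrow> p l = 0" and p0: "p 0 \<noteq> 0"
  obtains \<sigma> q where "0 < \<sigma>" "q \<in> Aw G (\<lambda>l. exp (- (coord_sum l * \<sigma>)))"
    "\<And>z t. \<sigma> \<le> Re z \<Longrightarrow> transform G q (line z t) = 1 / transform G p (line z t)"
proof -
  define y where "y l = unit_elem l - 1 / p 0 * p l" for l
  have y0: "y l = 0" if "l \<notin> F - {0}" for l
    using that p p0 by (auto simp: y_def unit_elem_def)
  have yF: "finite (F - {0})" "F - {0} \<subseteq> G" "F - {0} \<subseteq> G - {0}" using F by auto
  have "((\<lambda>\<sigma>. \<Sum>l\<in>F - {0}. exp (- (coord_sum l * \<sigma>)) *\<^sub>R norm (y l)) \<longlongrightarrow> 0) at_top"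
    by (rule tendsto_decay_sum[OF G yF(3)])
  then have "\<forall>\<^sub>F \<sigma> in at_top. (\<Sum>l\<in>F - {0}. exp (- (coord_sum l * \<sigma>)) *\<^sub>R norm (y l)) < 1"
    by (rule order_tendstoD) simp
  then have "\<forall>\<^sub>F \<sigma> in at_top. 0 < \<sigma> \<and> (\<Sum>l\<in>F - {0}. exp (- (coord_sum l * \<sigma>)) *\<^sub>R norm (y l)) < 1"
    using eventually_gt_at_top[of 0] by eventually_elim simp
  then obtain \<sigma> where \<sigma>: "0 < \<sigma>" "(\<Sum>l\<in>F - {0}. exp (- (coord_sum l * \<sigma>)) *\<^sub>R norm (y l)) < 1"
    using eventually_happens'[OF trivial_limit_at_top_linorder] by blast
  define v where "v l = exp (- (coord_sum l * \<sigma>))" for l :: "real ^ 'r"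
  have wv: "weight_function G v" unfolding v_def by (rule exp_weight[OF G])
  have v: "0 < v l" for l by (simp add: v_def)
  have dom: "line z t \<in> transform_domain G v" if "\<sigma> \<le> Re z" for z t
    unfolding v_def by (rule line_in_transform_domain[OF G that])
  have yA: "y \<in> Aw G v"
    by (rule finite_support(1)[of "F - {0}"]) (use y0 yF in auto)
  have Ny: "wnorm G v y < 1"
    using \<sigma>(2) by (subst finite_support(3)[of "F - {0}"]) (use y0 yF in \<open>auto simp: v_def mult.commute\<close>)
  have Ny0: "0 \<le> wnorm G v y"
    unfolding wnorm_def using v by (intro infsum_nonneg) (simp add: less_imp_le)
  have pA: "p \<in> Aw G v"
    by (rule finite_support(1)[of F]) (use p F in auto)
  have "\<forall>k. \<exists>e. e \<in> Aw G v \<and> wnorm G v e \<le> wnorm G v y ^ k \<and>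
      (\<forall>s\<in>transform_domain G v. transform G e s = transform G y s ^ k)"
    using power_elem[OF G wv yA] by blast
  then obtain e where e: "\<And>k. e k \<in> Aw G v" "\<And>k. wnorm G v (e k) \<le> wnorm G v y ^ k"
      "\<And>k s. s \<in> transform_domain G v \<Longrightarrow> transform G (e k) s = transform G y s ^ k"
    by metis
  have "summable (\<lambda>k. wnorm G v (e k))"
  proof (rule summable_comparison_test)
    show "\<exists>N. \<forall>n\<ge>N. norm (wnorm G v (e n)) \<le> wnorm G v y ^ n"
      using e(2) v by (auto simp: wnorm_def infsum_nonneg less_imp_le)
  qed (use Ny Ny0 in \<open>simp add: summable_geometric\<close>)
  from series_elem[OF v e(1) this] obtain b where b: "b \<in> Aw G v"
    "\<And>s. s \<in> transform_domain G v \<Longrightarrow> (\<lambda>k. transform G (e k) s) sums transform G b s" by blast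
  have "transform G (\<lambda>l. 1 / p 0 * b l) s = 1 / transform G p s" if s: "s \<in> transform_domain G v" for s
  proof -
    have "norm (transform G y s) < 1"
      using norm_transform_le[OF yA s] Ny by simp
    then have "(\<lambda>k. transform G y s ^ k) sums (1 / (1 - transform G y s))"
      by (rule geometric_sums)
    moreover have "(\<lambda>k. transform G y s ^ k) sums transform G b s"
      using b(2)[OF s] e(3)[OF s] by simp
    ultimately have "transform G b s = 1 / (1 - transform G y s)"
      using sums_unique2 by blast
    moreover have "transform G y s = 1 - 1 / p 0 * transform G p s"
      unfolding y_def
      by (subst transform_diff[OF unit_elem_facts(1)[OF G wv] Aw_cmult[OF pA] s])
        (simp only: transform_cmult unit_elem_facts(2)[OF G wv])
    ultimately show ?thesis
      unfolding transform_cmult using p0 by (simp add: field_simps)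
  qed
  then show ?thesis
    using that[OF \<sigma>(1), of "\<lambda>l. 1 / p 0 * b l"] Aw_cmult[OF b(1)] dom unfolding v_def by blast
qed

text \<open>The Neumann series exists only for an exponential weight. Holomorphy and the bound
  \<open>(1 / \<eta>) ^ m\<close> on a half-plane beyond the imaginary axis upgrade its powers to
  exponentially decaying coefficients, and decay beats \<open>w\<close> on a finitely generated
  semigroup.\<close>

lemma inverse_powers:
  fixes p :: "real ^ 'r \<Rightarrow> complex"
  assumes L: "nonneg_semigroup L" and w: "admissible_weight L w"
    and F: "finite F" "0 \<in> F" "F \<subseteq> L" and p: "\<And>l. l \<notin> F \<Longrightarrow> p l = 0"
    and lower: "\<And>s. s \<in> Hr \<Longrightarrow> \<delta> \<le> norm (transform L p s)" and \<eta>: "0 < \<eta>" "\<eta> < \<delta>"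
  obtains \<sigma> C q where "0 < \<sigma>" "\<And>m :: nat. q m \<in> Aw L w" "\<And>m. wnorm L w (q m) \<le> C * (1 / \<eta>) ^ m"
    "\<And>m z t. \<sigma> \<le> Re z \<Longrightarrow> transform L (q m) (line z t) = (1 / transform L p (line z t)) ^ m"
proof -
  define P where "P s = (\<Sum>l\<in>F. p l * exp (- dotc l s))" for s
  \<comment> \<open>All inverse powers are built over \<open>G\<close> instead of \<open>L\<close>:
    the decay sum is available over a finitely generated semigroup. The generator 0 is left out
    because nothing decays along its multiples.\<close>
  define G where "G = semigroup_hull (F - {0})"
  have F0: "F - {0} \<subseteq> L - {0}" "F - {0} \<subseteq> L" "finite (F - {0})" using F by auto
  have G: "nonneg_semigroup G" unfolding G_def by (rule semigroup_hull_semigroup[OF L F0(2)])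
  have GL: "G \<subseteq> L" unfolding G_def by (rule semigroup_hull_subset[OF L F0(2)])
  have FG: "F \<subseteq> G"
    using subset_semigroup_hull[OF F0(3)] G by (auto simp: G_def nonneg_semigroup_def)
  have TP: "transform L p s = P s" "transform G p s = P s" for s
    using finite_support(2)[of F p, OF p F(1)] F(3) FG by (simp_all add: P_def)
  have lower': "\<delta> \<le> norm (P s)" if "s \<in> Hr" for s
    using lower[OF that] by (simp add: TP)
  obtain \<epsilon> where \<epsilon>: "0 < \<epsilon>" "\<And>z t. - \<epsilon> < Re z \<Longrightarrow> \<eta> \<le> norm (P (line z t))"
    using extended_lower_bound[OF L F(1,3) lower'[unfolded P_def] \<eta>(2)] unfolding P_def by blast
  have "\<delta> \<le> norm (p 0)"
    by (rule constant_term_bound[OF L F lower'[unfolded P_def]])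
  then have "p 0 \<noteq> 0" using \<eta> by auto
  then obtain \<sigma> q1 where \<sigma>: "0 < \<sigma>" "q1 \<in> Aw G (\<lambda>l. exp (- (coord_sum l * \<sigma>)))"
    "\<And>z t. \<sigma> \<le> Re z \<Longrightarrow> transform G q1 (line z t) = 1 / transform G p (line z t)"
    using neumann_inverse[of G F p, OF G F(1,2) FG p \<open>p 0 \<noteq> 0\<close>] by blast
  have "\<forall>m. \<exists>e. e \<in> Aw G (\<lambda>l. exp (- (coord_sum l * \<sigma>))) \<and>
      (\<forall>s\<in>transform_domain G (\<lambda>l. exp (- (coord_sum l * \<sigma>))). transform G e s = transform G q1 s ^ m)"
    using power_elem[OF G exp_weight[OF G] \<sigma>(2)] by blast
  then obtain e where e: "\<And>m. e m \<in> Aw G (\<lambda>l. exp (- (coord_sum l * \<sigma>)))"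
    "\<And>m s. s \<in> transform_domain G (\<lambda>l. exp (- (coord_sum l * \<sigma>))) \<Longrightarrow> transform G (e m) s = transform G q1 s ^ m"
    by metis
  have Te: "transform G (e m) (line z t) = (1 / P (line z t)) ^ m" if "\<sigma> \<le> Re z" for m z t
    using e(2)[OF line_in_transform_domain[OF G that]] \<sigma>(3)[OF that] by (simp add: TP)
  have decay: "norm (e m l) \<le> (1 / \<eta>) ^ m * exp (- (coord_sum l * (\<epsilon> / 2)))" if l: "l \<in> G" for m l
  proof -
    \<comment> \<open>The point \<open>- \<epsilon> / 2\<close> lies strictly inside the half-plane
      of boundedness and left of the imaginary axis.\<close>
    have "norm (e m l) \<le> (1 / \<eta>) ^ m * exp (coord_sum l * (- \<epsilon> / 2))"
    proof (rule coefficient_bound[OF G e(1), where \<Phi> = "\<lambda>s. (1 / P s) ^ m" and \<epsilon> = \<epsilon>])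
      show "- \<epsilon> < \<sigma>" "- \<epsilon> < - \<epsilon> / 2" using \<epsilon>(1) \<sigma>(1) by auto
      have nz: "P (line z t) \<noteq> 0" if "- \<epsilon> < Re z" for z t
        using \<epsilon>(2)[OF that, of t] \<eta>(1) by auto
      have "(\<lambda>z. P (line z t)) holomorphic_on {z. - \<epsilon> < Re z}" for t
        unfolding P_def dotc_line by (intro holomorphic_intros)
      then show "(\<lambda>z. (1 / P (line z t)) ^ m) holomorphic_on {z. - \<epsilon> < Re z}" for t
        by (intro holomorphic_intros) (use nz in auto)
      show "norm ((1 / P (line z t)) ^ m) \<le> (1 / \<eta>) ^ m" if "- \<epsilon> < Re z" for z t
        unfolding norm_power using \<epsilon>(2)[OF that, of t] \<eta>(1)
        by (intro power_mono) (auto simp: norm_divide frac_le)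
    qed (use Te l in auto)
    then show ?thesis by simp
  qed
  \<comment> \<open>This constant is independent of \<open>m\<close>, so the weighted norms grow no
    faster than the bound \<open>(1 / \<eta>) ^ m\<close> on the transforms.\<close>
  define C where "C = (\<Sum>\<^sub>\<infinity>l\<in>G. exp (- (coord_sum l * (\<epsilon> / 2))) * w l)"
  have Cs: "(\<lambda>l. exp (- (coord_sum l * (\<epsilon> / 2))) * w l) summable_on G"
    unfolding G_def by (rule semigroup_hull_decay_summable[OF L w F0(3,1)]) (use \<epsilon> in simp)
  have w0: "0 \<le> w l" if "l \<in> G" for l
    using w GL that by (auto simp: admissible_weight_def weight_function_def less_imp_le)
  \<comment> \<open>Nothing is known about \<open>e m\<close> outside \<open>G\<close>, hence the
    extension by zero to \<open>L\<close>.\<close>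
  define q where "q m l = (if l \<in> G then e m l else 0)" for m l
  have le: "norm (e m l) * w l \<le> (1 / \<eta>) ^ m * (exp (- (coord_sum l * (\<epsilon> / 2))) * w l)" if "l \<in> G" for m l
    using mult_right_mono[OF decay[OF that] w0[OF that]] by (simp add: mult.assoc)
  have es: "(\<lambda>l. norm (e m l) * w l) summable_on G" for m
    by (rule summable_on_comparison_test[OF summable_on_cmult_right[OF Cs] le]) (use w0 in simp_all)
  have "(\<lambda>l. norm (q m l) * w l) summable_on L \<longleftrightarrow> (\<lambda>l. norm (e m l) * w l) summable_on G" for m
    by (rule summable_on_cong_neutral) (use GL in \<open>auto simp: q_def\<close>)
  then have qA: "q m \<in> Aw L w" for m using es by (simp add: Aw_def)
  have "wnorm L w (q m) = (\<Sum>\<^sub>\<infinity>l\<in>G. norm (e m l) * w l)" for m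
    unfolding wnorm_def by (rule infsum_cong_neutral) (use GL in \<open>auto simp: q_def\<close>)
  moreover have "\<dots> m \<le> (\<Sum>\<^sub>\<infinity>l\<in>G. (1 / \<eta>) ^ m * (exp (- (coord_sum l * (\<epsilon> / 2))) * w l))" for m
    by (rule infsum_mono[OF es summable_on_cmult_right[OF Cs] le])
  ultimately have qN: "wnorm L w (q m) \<le> C * (1 / \<eta>) ^ m" for m
    by (simp add: C_def infsum_cmult_right' mult.commute)
  have "transform L (q m) s = transform G (e m) s" for m s
    unfolding transform_def by (rule infsum_cong_neutral) (use GL in \<open>auto simp: q_def\<close>)
  then have "transform L (q m) (line z t) = (1 / transform L p (line z t)) ^ m" if "\<sigma> \<le> Re z" for m z t
    using Te[OF that] by (simp add: TP)
  with that[OF \<sigma>(1) qA qN] show ?thesis by blast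
qed

section \<open>Approximation by finite support and the inverse of \<open>a\<close>\<close>

lemma Hr_subset_transform_domain:
  fixes L :: "(real ^ 'r) set"
  assumes L: "nonneg_semigroup L" and w: "\<And>l. l \<in> L \<Longrightarrow> 1 \<le> w l"
  shows "Hr \<subseteq> transform_domain L w"
proof
  fix s :: "complex ^ 'r" assume "s \<in> Hr"
  have "norm (exp (- dotc l s)) \<le> w l" if l: "l \<in> L" for l
  proof -
    have "0 \<le> (\<Sum>i\<in>UNIV. l $ i * Re (s $ i))"
      by (intro sum_nonneg mult_nonneg_nonneg)
        (use L l \<open>s \<in> Hr\<close> in \<open>auto simp: nonneg_semigroup_def Hr_def less_imp_le\<close>)
    then have "0 \<le> Re (dotc l s)" by (simp add: dotc_def)
    then show ?thesis using w[OF l] by (auto intro: order_trans[of _ 1])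
  qed
  then show "s \<in> transform_domain L w" unfolding transform_domain_def by blast
qed

lemma truncation:
  assumes a: "a \<in> Aw L w" and "0 < \<delta>" "0 \<in> L" and w: "\<And>l. l \<in> L \<Longrightarrow> 0 \<le> w l"
  obtains F where "finite F" "0 \<in> F" "F \<subseteq> L" "wnorm L w (\<lambda>l. (if l \<in> F then a l else 0) - a l) \<le> \<delta>"
proof -
  let ?f = "\<lambda>l. norm (a l) * w l"
  obtain F where F: "finite F" "F \<subseteq> L" "dist (sum ?f F) (infsum ?f L) \<le> \<delta>"
    using infsum_finite_approximation[OF Aw_D[OF a] \<open>0 < \<delta>\<close>] by blast
  \<comment> \<open>Putting 0 into the finite set can only shrink the tail; its presence is required
    for inverting the truncation by its constant term.\<close>
  have "wnorm L w (\<lambda>l. (if l \<in> insert 0 F then a l else 0) - a l) = (\<Sum>\<^sub>\<infinity>l\<in>L - insert 0 F. ?f l)"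
    unfolding wnorm_def by (rule infsum_cong_neutral) auto
  also have "\<dots> \<le> (\<Sum>\<^sub>\<infinity>l\<in>L - F. ?f l)"
    by (rule infsum_mono2) (use w F in \<open>auto intro: summable_on_subset_banach[OF Aw_D[OF a]]\<close>)
  also have "\<dots> = infsum ?f L - sum ?f F"
    using infsum_Diff[OF Aw_D[OF a] summable_on_finite[OF F(1)] F(2)] F(1) by simp
  also have "\<dots> \<le> \<delta>" using F(3) by (simp add: dist_real_def)
  finally show ?thesis using that[of "insert 0 F"] F \<open>0 \<in> L\<close> by simp
qed

theorem theorem4:
  fixes L :: "(real ^ 'r) set" and w :: "real ^ 'r \<Rightarrow> real" and a :: "real ^ 'r \<Rightarrow> complex"
  assumes "nonneg_semigroup L"
    and "admissible_weight L w"
    and "a \<in> Aw L w"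
    and "0 \<notin> closure (transform L a ` Hr)"
  shows "\<exists>b \<in> Aw L w. (\<forall>l\<in>L. conv L a b l = unit_elem l) \<and> (\<forall>l\<in>L. conv L b a l = unit_elem l)"
proof -
  note L = assms(1) and a = assms(3)
  have w: "weight_function L w" and w1: "\<And>l. l \<in> L \<Longrightarrow> 1 \<le> w l"
    using assms(2) by (auto simp: admissible_weight_def)
  then have wpos: "0 < w l" if "l \<in> L" for l
    using that by (simp add: weight_function_def)
  have dom: "s \<in> transform_domain L w" if "s \<in> Hr" for s
    using Hr_subset_transform_domain[of L w] L w1 that by blast
  obtain \<delta> where \<delta>: "0 < \<delta>" "\<And>s. s \<in> Hr \<Longrightarrow> \<delta> \<le> norm (transform L a s)"
    using assms(4) unfolding closure_approachable by (force simp: not_less)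
  \<comment> \<open>An error of \<open>\<delta> / 4\<close> leaves the truncation the lower bound
    \<open>3 * \<delta> / 4\<close>. The rate \<open>\<eta> = \<delta> / 2\<close> lies strictly
    below that bound and above the error, so the series below has ratio
    \<open>(\<delta> / 4) / (\<delta> / 2) = 1 / 2\<close>.\<close>
  obtain F where F: "finite F" "0 \<in> F" "F \<subseteq> L"
    "wnorm L w (\<lambda>l. (if l \<in> F then a l else 0) - a l) \<le> \<delta> / 4"
    by (rule truncation[OF a, of "\<delta> / 4"])
      (use \<delta>(1) L wpos in \<open>simp_all add: nonneg_semigroup_def less_imp_le\<close>)
  define p where "p l = (if l \<in> F then a l else 0)" for l
  define r where "r l = p l - a l" for l
  have p: "p l = 0" if "l \<notin> F" for l using that by (simp add: p_def)
  have pA: "p \<in> Aw L w"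
    by (rule finite_support(1)[of F]) (use p F in auto)
  have rA: "r \<in> Aw L w"
    unfolding r_def by (rule Aw_diff[OF pA a]) (use wpos in \<open>simp add: less_imp_le\<close>)
  have rN: "wnorm L w r \<le> \<delta> / 4" using F(4) by (simp add: r_def[abs_def] p_def)
  have Tr: "transform L r s = transform L p s - transform L a s" if "s \<in> Hr" for s
    unfolding r_def by (rule transform_diff[OF pA a dom[OF that]])
  have rle: "norm (transform L r s) \<le> \<delta> / 4" if "s \<in> Hr" for s
    using norm_transform_le[OF rA dom[OF that]] rN by simp
  have plow: "3 * \<delta> / 4 \<le> norm (transform L p s)" if "s \<in> Hr" for s
    using rle[OF that] \<delta>(2)[OF that] norm_triangle_ineq3[of "transform L p s" "transform L a s"]
    unfolding Tr[OF that] by linarith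
  have \<eta>: "0 < \<delta> / 2" "\<delta> / 2 < 3 * \<delta> / 4" using \<delta>(1) by auto
  obtain \<sigma> C q where \<sigma>: "0 < \<sigma>" and q: "\<And>m :: nat. q m \<in> Aw L w" "\<And>m. wnorm L w (q m) \<le> C * (1 / (\<delta> / 2)) ^ m"
    "\<And>m z t. \<sigma> \<le> Re z \<Longrightarrow> transform L (q m) (line z t) = (1 / transform L p (line z t)) ^ m"
    by (rule inverse_powers[of L w F p, OF L assms(2) F(1-3) p plow \<eta>]; (assumption | rule that))
  have "\<forall>k. \<exists>e. e \<in> Aw L w \<and> wnorm L w e \<le> wnorm L w r ^ k \<and>
      (\<forall>s\<in>transform_domain L w. transform L e s = transform L r s ^ k)"
    using power_elem[OF L w rA] by blast
  then obtain e where e: "\<And>k. e k \<in> Aw L w" "\<And>k. wnorm L w (e k) \<le> wnorm L w r ^ k"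
      "\<And>k s. s \<in> transform_domain L w \<Longrightarrow> transform L (e k) s = transform L r s ^ k"
    by metis
  \<comment> \<open>As \<open>a = p - r\<close>, the inverse is formally the sum of
    \<open>r ^ k / p ^ Suc k\<close>; \<open>d k\<close> represents its \<open>k\<close>-th
    term.\<close>
  define d where "d k = conv L (q (Suc k)) (e k)" for k
  note dc = conv_weighted[OF L w q(1) e(1), folded d_def]
  have nn: "0 \<le> wnorm L w c" for c
    unfolding wnorm_def using wpos by (intro infsum_nonneg) (simp add: less_imp_le)
  have dN: "wnorm L w (d k) \<le> C * (2 / \<delta>) * (1 / 2) ^ k" for k
  proof -
    have "wnorm L w (d k) \<le> wnorm L w (q (Suc k)) * wnorm L w (e k)"
      unfolding d_def by (rule conv_weighted(2)[OF L w q(1) e(1)])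
    also have "\<dots> \<le> (C * (1 / (\<delta> / 2)) ^ Suc k) * (\<delta> / 4) ^ k"
      by (rule mult_mono[OF q(2) order_trans[OF e(2) power_mono[OF rN nn]] order_trans[OF nn q(2)] nn])
    also have "\<dots> = C * (2 / \<delta>) * ((2 / \<delta>) * (\<delta> / 4)) ^ k"
      by (simp only: power_Suc power_mult_distrib) simp
    also have "(2 / \<delta>) * (\<delta> / 4) = 1 / 2" using \<delta>(1) by simp
    finally show ?thesis .
  qed
  have "summable (\<lambda>k. wnorm L w (d k))"
  proof (rule summable_comparison_test)
    show "\<exists>N. \<forall>n\<ge>N. norm (wnorm L w (d n)) \<le> C * (2 / \<delta>) * (1 / 2) ^ n"
      using dN nn by simp
  qed (intro summable_mult summable_geometric, simp)
  from series_elem[OF wpos _ this] obtain b where b: "b \<in> Aw L w"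
    "\<And>s. s \<in> transform_domain L w \<Longrightarrow> (\<lambda>k. transform L (d k) s) sums transform L b s"
    using conv_weighted(1)[OF L w q(1) e(1)] unfolding d_def by blast
  \<comment> \<open>The transforms of the \<open>q m\<close> are known only for
    \<open>\<sigma> \<le> Re z\<close>. Verifying the inverse relation there is enough, since the
    transform on this set already determines the coefficients.\<close>
  have Tb: "transform L a (line z t) * transform L b (line z t) = 1" if z: "\<sigma> \<le> Re z" for z t
  proof -
    let ?s = "line z t"
    have s: "?s \<in> Hr" by (rule line_Hr) (use z \<sigma> in simp)
    let ?P = "transform L p ?s" and ?R = "transform L r ?s"
    have P: "?P \<noteq> 0" and A: "transform L a ?s \<noteq> 0" using plow[OF s] \<delta>(2)[OF s] \<delta>(1) by auto
    have "norm (?R / ?P) < 1"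
      using rle[OF s] plow[OF s] \<delta>(1) P by (simp add: norm_divide divide_simps)
    then have "(\<lambda>k. 1 / ?P * (?R / ?P) ^ k) sums (1 / ?P * (1 / (1 - ?R / ?P)))"
      by (intro sums_mult geometric_sums)
    moreover have "transform L (d k) ?s = 1 / ?P * (?R / ?P) ^ k" for k
      unfolding d_def conv_weighted(3)[OF L w q(1) e(1) dom[OF s]] q(3)[OF z] e(3)[OF dom[OF s]]
      by (simp add: power_divide)
    ultimately have "transform L b ?s = 1 / ?P * (1 / (1 - ?R / ?P))"
      using b(2)[OF dom[OF s]] sums_unique2 by simp
    also have "\<dots> = 1 / transform L a ?s"
      using P by (simp add: Tr[OF s] field_simps)
    finally show ?thesis using A by simp
  qed
  have unit: "c l = unit_elem l" if c: "c \<in> Aw L w" and l: "l \<in> L"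
    and Tc: "\<And>z t. \<sigma> \<le> Re z \<Longrightarrow> transform L c (line z t) = 1" for c l
  proof -
    have cu: "(\<lambda>l. c l - unit_elem l) \<in> Aw L w"
      by (rule Aw_diff[OF c unit_elem_facts(1)[OF L w]]) (use wpos in \<open>simp add: less_imp_le\<close>)
    \<comment> \<open>Uniqueness was proved for exponential weights; these are at most 1 on
      \<open>L\<close> and hence dominated by \<open>w\<close>.\<close>
    have "(\<lambda>l. c l - unit_elem l) \<in> Aw L (\<lambda>l. exp (- (coord_sum l * \<sigma>)))"
      unfolding Aw_def mem_Collect_eq
    proof (rule summable_on_comparison_test[OF Aw_D[OF cu]])
      fix l assume l: "l \<in> L"
      have "exp (- (coord_sum l * \<sigma>)) \<le> 1" using coord_sum_nonneg[OF L l] \<sigma> by simp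
      then have "exp (- (coord_sum l * \<sigma>)) \<le> w l" using w1[OF l] by (rule order_trans)
      then show "norm (c l - unit_elem l) * exp (- (coord_sum l * \<sigma>)) \<le> norm (c l - unit_elem l) * w l"
        by (rule mult_left_mono) simp
    qed simp
    moreover have "transform L (\<lambda>l. c l - unit_elem l) (line z t) = 0" if "\<sigma> \<le> Re z" for z t
      by (subst transform_diff[OF c unit_elem_facts(1)[OF L w] dom[OF line_Hr]])
        (use that \<sigma> Tc unit_elem_facts(2)[OF L w] in auto)
    ultimately show ?thesis using transform_eq_zeroD[OF L _ _ l] by fastforce
  qed
  have ldom: "line z t \<in> transform_domain L w" if "\<sigma> \<le> Re z" for z t
    by (rule dom, rule line_Hr) (use that \<sigma> in simp)
  have "conv L a b l = unit_elem l" if "l \<in> L" for l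
  proof (rule unit[OF conv_weighted(1)[OF L w a b(1)] that])
    show "transform L (conv L a b) (line z t) = 1" if "\<sigma> \<le> Re z" for z t
      using conv_weighted(3)[OF L w a b(1) ldom[OF that]] Tb[OF that] by simp
  qed
  moreover have "conv L b a l = unit_elem l" if "l \<in> L" for l
  proof (rule unit[OF conv_weighted(1)[OF L w b(1) a] that])
    show "transform L (conv L b a) (line z t) = 1" if "\<sigma> \<le> Re z" for z t
      using conv_weighted(3)[OF L w b(1) a ldom[OF that]] Tb[OF that] by (simp add: mult.commute)
  qed
  ultimately show ?thesis using b(1) by blast
qed

end
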